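(* (i) For $n\ge2$, every nonempty shell of $\mathbb Z^n$ and of $\mathrm{Sh}(\mathbb Z^n)$ is a spherical $3$-design. (ii) The following shells are spherical $3\tfrac12$-designs: every nonempty shell of $\mathbb Z^2$ and of $\mathrm{Sh}(\mathbb Z^2)$; $(\mathbb Z^{16})_m$ for $m=2\cdot4^a$, $a\ge0$; $\mathrm{Sh}(\mathbb Z^{16})_m$ for $m=2\cdot4^a$, $a\ge1$; $\mathrm{Sh}(\mathbb Z^{40})_{24}$. (iii) The following shells are spherical $5$-designs: $(\mathbb Z^4)_m$ for $m=2a$, $a\ge1$; $(\mathbb Z^7)_m$ for $m=4^a(8b+3)$, $a,b\ge0$; $\mathrm{Sh}(\mathbb Z^{16})_m$ for $m=4a+2$, $a\ge1$.
   Context: $\mathbb Z^n\subset\mathbb R^n$ is the cubic lattice; its shadow is $\mathrm{Sh}(\mathbb Z^n)=(\mathbb Z+\tfrac12)^n$. For $A\subset\mathbb R^n$, the shell of norm $m$ is $A_m=\{x\in A:\langle x,x\rangle=m\}$. Spherical designs (all sets here are antipodal, $X=-X$): for a nonempty finite antipodal $X$ on a sphere centred at $0$ and $j\ge1$, condition $(C_{2j})$ means $\sum_{x\in X}P(x)=0$ for every homogeneous harmonic polynomial $P$ of degree $2j$ on $\mathbb R^n$. $X$ is a spherical $t$-design ($t$ a positive integer) iff $(C_{2j})$ holds for all $2\le 2j\le t$. $X$ is a spherical $(2s+1+\tfrac12)$-design iff $(C_{2j})$ holds for all $2\le2j\le2s$ and for $2j=2s+4$; thus a $3\tfrac12$-design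 satisfies $(C_2)$ and $(C_6)$. *)

theory Defs
  imports Main Complex_Main
begin

text \<open>Points of R^n are represented as functions nat => real that vanish
 outside the index set {0..<n}.\<close>

definition cubic_shell :: "nat \<Rightarrow> real \<Rightarrow> (nat \<Rightarrow> real) set" where
  "cubic_shell n m = {x. (\<forall>i<n. x i \<in> \<int>) \<and> (\<forall>i\<ge>n. x i = 0) \<and> (\<Sum>i<n. (x i)^2) = m}"

definition shadow_shell :: "nat \<Rightarrow> real \<Rightarrow> (nat \<Rightarrow> real) set" where
  "shadow_shell n m = {x. (\<forall>i<n. x i - 1/2 \<in> \<int>) \<and> (\<forall>i\<ge>n. x i = 0) \<and> (\<Sum>i<n. (x i)^2) = m}"

definition multi_idx :: "nat \<Rightarrow> nat \<Rightarrow> (nat \<Rightarrow> nat) set" where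
  "multi_idx n d = {\<alpha>. (\<forall>i\<ge>n. \<alpha> i = 0) \<and> (\<Sum>i<n. \<alpha> i) = d}"

definition hpoly_eval :: "nat \<Rightarrow> nat \<Rightarrow> ((nat \<Rightarrow> nat) \<Rightarrow> real) \<Rightarrow> (nat \<Rightarrow> real) \<Rightarrow> real" where
  "hpoly_eval n d c x = (\<Sum>\<alpha>\<in>multi_idx n d. c \<alpha> * (\<Prod>i<n. x i ^ \<alpha> i))"

text \<open>Harmonicity: the Laplacian of P vanishes. The coefficient of x^beta
  (beta of degree d-2) in Laplacian(P) is
  sum_i (beta_i+2)(beta_i+1) c(beta + 2 e_i).\<close>
definition harmonic_coeffs :: "nat \<Rightarrow> nat \<Rightarrow> ((nat \<Rightarrow> nat) \<Rightarrow> real) \<Rightarrow> bool" where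
  "harmonic_coeffs n d c \<longleftrightarrow> 2 \<le> d \<and>
     (\<forall>\<beta>\<in>multi_idx n (d - 2).
        (\<Sum>i<n. real ((\<beta> i + 2) * (\<beta> i + 1)) * c (\<beta>(i := \<beta> i + 2))) = 0)"

definition antipodal_spherical :: "nat \<Rightarrow> (nat \<Rightarrow> real) set \<Rightarrow> bool" where
  "antipodal_spherical n X \<longleftrightarrow> finite X \<and> X \<noteq> {} \<and>
     (\<forall>x\<in>X. \<forall>i\<ge>n. x i = 0) \<and>
     (\<forall>x\<in>X. (\<lambda>i. - x i) \<in> X) \<and>
     (\<exists>r. \<forall>x\<in>X. (\<Sum>i<n. (x i)^2) = r)"

definition design_cond :: "nat \<Rightarrow> (nat \<Rightarrow> real) set \<Rightarrow> nat \<Rightarrow> bool" where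
  "design_cond n X k \<longleftrightarrow> (\<forall>c. harmonic_coeffs n k c \<longrightarrow> (\<Sum>x\<in>X. hpoly_eval n k c x) = 0)"

definition sph_design :: "nat \<Rightarrow> (nat \<Rightarrow> real) set \<Rightarrow> nat \<Rightarrow> bool" where
  "sph_design n X t \<longleftrightarrow> antipodal_spherical n X \<and>
     (\<forall>j. 1 \<le> j \<and> 2 * j \<le> t \<longrightarrow> design_cond n X (2 * j))"

text \<open>Spherical (2s+1+1/2)-design.\<close>
definition sph_half_design :: "nat \<Rightarrow> (nat \<Rightarrow> real) set \<Rightarrow> nat \<Rightarrow> bool" where
  "sph_half_design n X s \<longleftrightarrow> antipodal_spherical n X \<and>
     (\<forall>j. 1 \<le> j \<and> 2 * j \<le> 2 * s \<longrightarrow> design_cond n X (2 * j)) \<and>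
     design_cond n X (2 * s + 4)"

end

theory Submission
  imports Defs "HOL-Computational_Algebra.Formal_Power_Series" "HOL-Computational_Algebra.Primes"
begin

unbundle fps_syntax

text \<open>The moments of a shell are coefficients of products of the power series
  sum x^j q^(x^2), so they vanish for odd exponents and depend only on the multiset of exponents.
  Pairing with the dual of the Laplacian, condition (C2) is automatic, while (C4) and (C6) each become
  the vanishing of a single coefficient, of theta^n (f' - 2 f^2) and theta^n (f'' - 12 f f' + 16 f^3)
  respectively, where f is the logarithmic derivative of theta (for n = 2, (C6) is automatic too).
  With x, y, z the fourth powers of the Jacobi theta constants theta2, theta4, theta3, the relations
  z = x + y (Jacobi) and f2' + f3' = 4 f2 f3 (Halphen) follow from the 45 degree rotation of pairs of
  integers and half-integers. They turn the two expressions into xy/8 and xy(y - x)/8 for the cubic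
  lattice, and -yz/8 and yz(y + z)/8 for its shadow. The required vanishing then follows from the
  behaviour of x, y, z under q -> -q and q -> q^2. Non-emptiness comes from Lagrange's four-square
  theorem.\<close>

section \<open>Generating functions\<close>

text \<open>Everything takes place in formal power series, so vanishing is read off from explicit
  dissections instead of dimension counts; only n = 40 also needs a finite computation. (C4) and
  (C6) shrink to one equation for the following reason. Even exponents of degree 4 have two types up
  to permutation, (4) and (2,2), while a symmetric preimage under the transposed Laplacian has one
  free value. In degree 6 the types (6), (4,2), (2,2,2) stand against two free values, and for n = 2
  the last type is absent. Writing g_j for the ratio of the j-th to the zeroth one-variable moment,
  elimination leaves g_4 - 3 g_2^2 and g_6 - 15 g_4 g_2 + 30 g_2^3. With ' = q d/dq, the recursion
  g_(j+2) = g_j' + f g_j turns these into the expressions in f. Only one Halphen relation is proved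
  by rotation; q -> -q yields a second, and the derivative of Jacobi's identity takes the place of
  the third.\<close>

definition gen_fun :: "'a set \<Rightarrow> ('a \<Rightarrow> nat) \<Rightarrow> ('a \<Rightarrow> real) \<Rightarrow> real fps" where
  "gen_fun A N w = Abs_fps (\<lambda>n. \<Sum>x | x \<in> A \<and> N x = n. w x)"

text \<open>A sum over an infinite set is 0 in HOL, so products and disjoint unions of index sets
  match products and sums of series only when the fibres are finite.\<close>

definition finite_fibres :: "'a set \<Rightarrow> ('a \<Rightarrow> nat) \<Rightarrow> bool" where
  "finite_fibres A N \<longleftrightarrow> (\<forall>n. finite {x. x \<in> A \<and> N x = n})"

lemma gen_fun_nth: "gen_fun A N w $ n = (\<Sum>x | x \<in> A \<and> N x = n. w x)"
  by (simp add: gen_fun_def)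

lemma gen_fun_cong:
  assumes "\<And>x. x \<in> A \<Longrightarrow> N x = M x" "\<And>x. x \<in> A \<Longrightarrow> w x = v x"
  shows "gen_fun A N w = gen_fun A M v"
  unfolding gen_fun_def using assms
  by (intro arg_cong[of _ _ Abs_fps] ext sum.cong) auto

lemma gen_fun_add: "gen_fun A N (\<lambda>x. w x + v x) = gen_fun A N w + gen_fun A N v"
  by (rule fps_ext) (simp add: gen_fun_nth sum.distrib)

lemma gen_fun_cmult: "gen_fun A N (\<lambda>x. c * w x) = fps_const c * gen_fun A N w"
  by (rule fps_ext) (simp add: gen_fun_nth sum_distrib_left)

lemma gen_fun_bij:
  assumes "bij_betw h A B" "\<And>x. x \<in> A \<Longrightarrow> N x = M (h x)" "\<And>x. x \<in> A \<Longrightarrow> w x = v (h x)"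
  shows "gen_fun A N w = gen_fun B M v"
proof (rule fps_ext)
  fix n
  have "bij_betw h {x. x \<in> A \<and> N x = n} {x. x \<in> B \<and> M x = n}"
    using assms(1,2) unfolding bij_betw_def by (auto intro: inj_on_subset)
  then show "gen_fun A N w $ n = gen_fun B M v $ n"
    unfolding gen_fun_nth using sum.reindex_bij_betw[of h _ _ v] assms(3)
    by (metis (mono_tags, lifting) mem_Collect_eq sum.cong)
qed

lemma gen_fun_Un:
  assumes "finite_fibres (A \<union> B) N" "A \<inter> B = {}"
  shows "gen_fun (A \<union> B) N w = gen_fun A N w + gen_fun B N w"
proof (rule fps_ext)
  fix n
  have "{x. x \<in> A \<union> B \<and> N x = n} = {x. x \<in> A \<and> N x = n} \<union> {x. x \<in> B \<and> N x = n}" by auto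
  moreover have "finite {x. x \<in> A \<and> N x = n}" "finite {x. x \<in> B \<and> N x = n}"
    using assms(1) by (auto simp: finite_fibres_def intro: rev_finite_subset)
  ultimately show "gen_fun (A \<union> B) N w $ n = (gen_fun A N w + gen_fun B N w) $ n"
    using assms(2) by (simp add: gen_fun_nth) (subst sum.union_disjoint; auto)
qed

lemma fibre_product:
  fixes N :: "'a \<Rightarrow> nat" and M :: "'b \<Rightarrow> nat"
  shows "{p. p \<in> A \<times> B \<and> (case p of (x, y) \<Rightarrow> N x + M y) = n} =
   (\<Union>i\<in>{0..n}. {x. x \<in> A \<and> N x = i} \<times> {y. y \<in> B \<and> M y = n - i})"
  by auto

lemma finite_fibres_Times:
  assumes "finite_fibres A N" "finite_fibres B M"
  shows "finite_fibres (A \<times> B) (\<lambda>(x, y). N x + M y)"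
  unfolding finite_fibres_def fibre_product
  using assms by (auto simp: finite_fibres_def)

lemma gen_fun_mult:
  assumes "finite_fibres A N" "finite_fibres B M"
  shows "gen_fun A N w * gen_fun B M v =
    gen_fun (A \<times> B) (\<lambda>(x, y). N x + M y) (\<lambda>(x, y). w x * v y)"
proof (rule fps_ext)
  fix n
  have "gen_fun (A \<times> B) (\<lambda>(x, y). N x + M y) (\<lambda>(x, y). w x * v y) $ n =
    (\<Sum>i\<in>{0..n}. \<Sum>(x, y)\<in>{x. x \<in> A \<and> N x = i} \<times> {y. y \<in> B \<and> M y = n - i}. w x * v y)"
    unfolding gen_fun_nth fibre_product using assms
    by (intro sum.UNION_disjoint) (auto simp: finite_fibres_def)
  then show "(gen_fun A N w * gen_fun B M v) $ n =
      gen_fun (A \<times> B) (\<lambda>(x, y). N x + M y) (\<lambda>(x, y). w x * v y) $ n"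
    by (simp add: fps_mult_nth gen_fun_nth sum_product sum.cartesian_product)
qed

lemma gen_fun_XD: "fps_XD (gen_fun A N w) = gen_fun A N (\<lambda>x. real (N x) * w x)"
  by (rule fps_ext) (simp add: gen_fun_nth sum_distrib_left)

lemma gen_fun_X_power_mult: "fps_X ^ c * gen_fun A N w = gen_fun A (\<lambda>x. N x + c) w"
  by (rule fps_ext) (auto simp: gen_fun_nth fps_X_power_mult_nth intro!: sum.cong)

lemma fps_compose_X_power_nth:
  fixes f :: "'a::comm_ring_1 fps"
  assumes "k > 0"
  shows "(f oo fps_X ^ k) $ n = (if k dvd n then f $ (n div k) else 0)"
proof -
  have "(f oo fps_X ^ k) $ n = (\<Sum>i = 0..n. if i * k = n then f $ i else 0)"
    by (auto simp: fps_compose_nth power_mult[symmetric] fps_X_power_nth mult.commute intro!: sum.cong)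
  also have "\<dots> = (if k dvd n then f $ (n div k) else 0)"
  proof (cases "k dvd n")
    case True
    then have "(\<lambda>i. i * k = n) = (\<lambda>i. i = n div k)" using assms by (auto simp: fun_eq_iff)
    then show ?thesis using True assms by (simp add: fun_eq_iff)
  next
    case False
    then show ?thesis by (auto intro!: sum.neutral)
  qed
  finally show ?thesis .
qed

lemma gen_fun_compose_X_power:
  assumes "k > 0"
  shows "gen_fun A N w oo fps_X ^ k = gen_fun A (\<lambda>x. k * N x) w"
  by (rule fps_ext) (use assms in \<open>auto simp: gen_fun_nth fps_compose_X_power_nth intro!: sum.cong sum.neutral\<close>)

section \<open>Theta series of the integers and half-integers\<close>

definition int_theta :: "nat \<Rightarrow> real fps" where
  "int_theta j = gen_fun UNIV (\<lambda>k::int. nat (k * k)) (\<lambda>k. of_int k ^ j)"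

text \<open>The exponent k (k + 1) is (k + 1/2)^2 - 1/4, a natural number; the weight keeps the true
  half-integer k + 1/2.\<close>

definition half_theta :: "nat \<Rightarrow> real fps" where
  "half_theta j = gen_fun UNIV (\<lambda>k::int. nat (k * (k + 1))) (\<lambda>k. (of_int k + 1/2) ^ j)"

lemma pronic_nonneg: "0 \<le> k * (k + 1)" for k :: int
  by (cases "k \<ge> 0") (auto intro: mult_nonneg_nonneg mult_nonpos_nonpos)

lemma finite_fibres_int: "finite_fibres UNIV (\<lambda>k::int. nat (k * k))"
  unfolding finite_fibres_def
proof
  fix n
  have "k \<in> {- int n..int n}" if "nat (k * k) = n" for k
  proof -
    have "int n = k * k" using that by auto
    moreover have "\<bar>k\<bar> * 1 \<le> \<bar>k\<bar> * \<bar>k\<bar>" by (cases "k = 0") (auto intro: mult_left_mono simp del: abs_mult_self_eq)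
    ultimately show ?thesis by auto
  qed
  then show "finite {k. k \<in> UNIV \<and> nat (k * k) = n}"
    by (intro finite_subset[OF _ finite_atLeastAtMost_int[of "- int n" "int n"]]) auto
qed

lemma finite_fibres_half: "finite_fibres UNIV (\<lambda>k::int. nat (k * (k + 1)))"
  unfolding finite_fibres_def
proof
  fix n
  have "k \<in> {- int n - 1..int n}" if "nat (k * (k + 1)) = n" for k
  proof -
    have n: "int n = k * (k + 1)" using that pronic_nonneg[of k] by auto
    show ?thesis
    proof (cases "k \<ge> 0")
      case True
      then have "k * 1 \<le> k * (k + 1)" by (intro mult_left_mono) auto
      with n True show ?thesis by auto
    next
      case False
      then have "(- (k + 1)) * 1 \<le> (- (k + 1)) * (- k)" by (intro mult_left_mono) auto
      with n False show ?thesis by (auto simp: algebra_simps)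
    qed
  qed
  then show "finite {k. k \<in> UNIV \<and> nat (k * (k + 1)) = n}"
    by (intro finite_subset[OF _ finite_atLeastAtMost_int[of "- int n - 1" "int n"]]) auto
qed

lemma int_theta_XD: "fps_XD (int_theta j) = int_theta (j + 2)"
  unfolding int_theta_def gen_fun_XD by (rule gen_fun_cong) (auto simp: power_add power2_eq_square)

lemma half_theta_XD: "fps_XD (half_theta j) = half_theta (j + 2) - fps_const (1/4) * half_theta j"
proof -
  have "half_theta (j + 2) = gen_fun UNIV (\<lambda>k::int. nat (k * (k + 1)))
     (\<lambda>k. real (nat (k * (k + 1))) * (of_int k + 1/2) ^ j + 1/4 * (of_int k + 1/2) ^ j)"
    unfolding half_theta_def
  proof (rule gen_fun_cong)
    fix k :: int
    have "real (nat (k * (k + 1))) = of_int k * (of_int k + 1)"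
      using pronic_nonneg[of k] by simp
    then show "(of_int k + 1/2) ^ (j + 2) =
        real (nat (k * (k + 1))) * (of_int k + 1/2) ^ j + 1/4 * (of_int k + 1/2) ^ j"
      by (simp only: power_add) (simp add: power2_eq_square field_simps)
  qed simp
  then show ?thesis
    unfolding gen_fun_add gen_fun_cmult half_theta_def gen_fun_XD by (simp add: algebra_simps)
qed

lemma int_theta_odd: "odd j \<Longrightarrow> int_theta j = 0"
proof -
  assume j: "odd j"
  have "int_theta j = gen_fun UNIV (\<lambda>k::int. nat (k * k)) (\<lambda>k. -1 * of_int k ^ j)"
    unfolding int_theta_def using j
    by (intro gen_fun_bij[where h = uminus]) (auto intro: bij_uminus)
  then have "int_theta j = - int_theta j"
    unfolding gen_fun_cmult int_theta_def[symmetric] by (simp flip: fps_const_neg)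
  then have "2 * int_theta j = 0" by (simp only: mult_2) simp
  then show ?thesis by simp
qed

lemma half_theta_odd: "odd j \<Longrightarrow> half_theta j = 0"
proof -
  assume j: "odd j"
  \<comment> \<open>In terms of the half-integer k + 1/2 this map is negation.\<close>
  have b: "bij (\<lambda>k::int. - 1 - k)" by (rule o_bij[of "\<lambda>k. - 1 - k"]) auto
  have "half_theta j = gen_fun UNIV (\<lambda>k::int. nat (k * (k + 1))) (\<lambda>k. -1 * (of_int k + 1/2) ^ j)"
    unfolding half_theta_def
  proof (rule gen_fun_bij[OF b])
    fix k :: int
    have "(of_int (- 1 - k) + 1/2 :: real) = - (of_int k + 1/2)" by simp
    then show "(of_int k + 1/2 :: real) ^ j = -1 * (of_int (- 1 - k) + 1/2) ^ j"
      using j by (simp only: uminus_power_if) simp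
  qed (simp add: algebra_simps)
  then have "half_theta j = - half_theta j"
    unfolding gen_fun_cmult half_theta_def[symmetric] by (simp flip: fps_const_neg)
  then have "2 * half_theta j = 0" by (simp only: mult_2) simp
  then show ?thesis by simp
qed

section \<open>Parity dissections and the 45 degree rotation\<close>

lemma int_theta_split: "int_theta 0 = (int_theta 0 oo fps_X ^ 4) + fps_X * (half_theta 0 oo fps_X ^ 4)"
proof -
  let ?N = "\<lambda>k::int. nat (k * k)"
  have *: "{k::int. even k} \<union> {k. odd k} = UNIV" by auto
  have "int_theta 0 = gen_fun {k. even k} ?N (\<lambda>_. 1) + gen_fun {k. odd k} ?N (\<lambda>_. 1)"
    using gen_fun_Un[of "{k. even k}" "{k. odd k}" ?N] finite_fibres_int
    unfolding * by (auto simp: int_theta_def)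
  also have "gen_fun {k. even k} ?N (\<lambda>_. 1) = int_theta 0 oo fps_X ^ 4"
    unfolding int_theta_def gen_fun_compose_X_power[OF zero_less_numeral]
    by (rule gen_fun_bij[symmetric, where h = "\<lambda>k. 2 * k"])
      (auto simp: bij_betw_def inj_on_def elim: evenE)
  also have "gen_fun {k. odd k} ?N (\<lambda>_. 1) = fps_X ^ 1 * (half_theta 0 oo fps_X ^ 4)"
    unfolding half_theta_def gen_fun_compose_X_power[OF zero_less_numeral] gen_fun_X_power_mult
  proof (rule gen_fun_bij[symmetric, where h = "\<lambda>k. 2 * k + 1"])
    show "bij_betw (\<lambda>k::int. 2 * k + 1) UNIV {k. odd k}"
      by (auto simp: bij_betw_def inj_on_def elim: oddE)
    show "4 * nat (k * (k + 1)) + 1 = nat ((2 * k + 1) * (2 * k + 1))" for k :: int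
      using pronic_nonneg[of k] by (simp add: nat_eq_iff algebra_simps)
  qed auto
  finally show ?thesis by simp
qed

lemma int_theta_square:
  "int_theta 0 ^ 2 = (int_theta 0 oo fps_X ^ 2) ^ 2 + fps_X * (half_theta 0 oo fps_X ^ 2) ^ 2"
proof -
  let ?N = "\<lambda>(u::int, v::int). nat (u * u) + nat (v * v)"
  let ?E = "{(u::int, v::int). even (u - v)}" and ?O = "{(u::int, v::int). odd (u - v)}"
  have *: "?E \<union> ?O = UNIV \<times> UNIV" by auto
  have ff: "finite_fibres (UNIV \<times> UNIV) ?N"
    by (rule finite_fibres_Times[OF finite_fibres_int finite_fibres_int])
  have "int_theta 0 ^ 2 = gen_fun (UNIV \<times> UNIV) ?N (\<lambda>_. 1)"
    unfolding power2_eq_square int_theta_def gen_fun_mult[OF finite_fibres_int finite_fibres_int]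
    by (simp add: case_prod_unfold)
  also have "\<dots> = gen_fun ?E ?N (\<lambda>_. 1) + gen_fun ?O ?N (\<lambda>_. 1)"
    using gen_fun_Un[of ?E ?O ?N] ff unfolding * by auto
  also have "gen_fun ?E ?N (\<lambda>_. 1) = (int_theta 0 * int_theta 0) oo fps_X ^ 2"
    unfolding int_theta_def
      gen_fun_mult[OF finite_fibres_int finite_fibres_int] gen_fun_compose_X_power[OF zero_less_numeral]
  \<comment> \<open>The rotation scaled by the square root of 2 doubles the norm and reaches exactly
    the pairs of equal parity.\<close>
  proof (rule gen_fun_bij[symmetric, where h = "\<lambda>(a, b). (a + b, a - b)"])
    show "bij_betw (\<lambda>(a::int, b). (a + b, a - b)) (UNIV \<times> UNIV) ?E"
      by (rule bij_betw_byWitness[where f' = "\<lambda>(u, v). ((u + v) div 2, (u - v) div 2)"])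
        (auto, presburger+)
    fix p :: "int \<times> int"
    show "2 * (case p of (x, y) \<Rightarrow> nat (x * x) + nat (y * y)) = ?N (case p of (a, b) \<Rightarrow> (a + b, a - b))"
      by (cases p) (simp add: nat_eq_iff algebra_simps flip: nat_add_distrib)
  qed auto
  also have "gen_fun ?O ?N (\<lambda>_. 1) = fps_X ^ 1 * ((half_theta 0 * half_theta 0) oo fps_X ^ 2)"
    unfolding half_theta_def
      gen_fun_mult[OF finite_fibres_half finite_fibres_half]
      gen_fun_compose_X_power[OF zero_less_numeral] gen_fun_X_power_mult
  \<comment> \<open>The same rotation applied to (a + 1/2, b + 1/2). The shift by 1 in the exponent
    is twice the two omitted quarters.\<close>
  proof (rule gen_fun_bij[symmetric, where h = "\<lambda>(a, b). (a + b + 1, a - b)"])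
    show "bij_betw (\<lambda>(a::int, b). (a + b + 1, a - b)) (UNIV \<times> UNIV) ?O"
      by (rule bij_betw_byWitness[where f' = "\<lambda>(u, v). ((u + v) div 2, (u - v) div 2)"])
        (auto, presburger+)
    fix p :: "int \<times> int"
    show "2 * (case p of (x, y) \<Rightarrow> nat (x * (x + 1)) + nat (y * (y + 1))) + 1 =
        ?N (case p of (a, b) \<Rightarrow> (a + b + 1, a - b))"
      using pronic_nonneg[of "fst p"] pronic_nonneg[of "snd p"]
      by (cases p) (simp add: nat_eq_iff algebra_simps flip: nat_add_distrib)
  qed auto
  finally show ?thesis by (simp add: fps_compose_mult_distrib power2_eq_square)
qed

text \<open>With s = k + 1/2 and t = l + 1/2, rotating Z x (Z + 1/2) gives the pairs (s, t) with k -
  l odd. The pairs with k - l even are reached after replacing t by -t, which \<open>w\<close> does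
  not notice; hence the factor 2.\<close>

lemma half_theta_pairs:
  fixes w :: "real \<Rightarrow> real \<Rightarrow> real"
  assumes w: "\<And>s t. w s (- t) = w s t"
  shows "gen_fun (UNIV \<times> UNIV) (\<lambda>(k::int, l::int). nat (k * (k + 1)) + nat (l * (l + 1)))
      (\<lambda>(k, l). w (of_int k + 1/2) (of_int l + 1/2)) =
    2 * (gen_fun (UNIV \<times> UNIV) (\<lambda>(a::int, b::int). nat (a * a) + nat (b * (b + 1)))
      (\<lambda>(a, b). w (of_int a + (of_int b + 1/2)) (of_int a - (of_int b + 1/2))) oo fps_X ^ 2)"
proof -
  let ?N = "\<lambda>(k::int, l::int). nat (k * (k + 1)) + nat (l * (l + 1))"
  let ?w = "\<lambda>(k::int, l::int). w (of_int k + 1/2) (of_int l + 1/2)"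
  let ?E = "{(u::int, v::int). even (u - v)}" and ?O = "{(u::int, v::int). odd (u - v)}"
  let ?G = "gen_fun (UNIV \<times> UNIV) (\<lambda>(a::int, b::int). nat (a * a) + nat (b * (b + 1)))
      (\<lambda>(a, b). w (of_int a + (of_int b + 1/2)) (of_int a - (of_int b + 1/2))) oo fps_X ^ 2"
  have *: "?E \<union> ?O = UNIV \<times> UNIV" by auto
  have "finite_fibres (UNIV \<times> UNIV) ?N"
    by (rule finite_fibres_Times[OF finite_fibres_half finite_fibres_half])
  then have "gen_fun (UNIV \<times> UNIV) ?N ?w = gen_fun ?E ?N ?w + gen_fun ?O ?N ?w"
    using gen_fun_Un[of ?E ?O ?N] unfolding * by auto
  also have "gen_fun ?O ?N ?w = ?G"
    unfolding gen_fun_compose_X_power[OF zero_less_numeral]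
  proof (rule gen_fun_bij[symmetric, where h = "\<lambda>(a, b). (a + b, a - b - 1)"])
    show "bij_betw (\<lambda>(a::int, b). (a + b, a - b - 1)) (UNIV \<times> UNIV) ?O"
      by (rule bij_betw_byWitness[where f' = "\<lambda>(u, v). ((u + v + 1) div 2, (u - v) div 2)"])
        (auto elim!: oddE simp: algebra_simps)
    fix p :: "int \<times> int"
    obtain a b where p: "p = (a, b)" by (cases p)
    show "2 * (case p of (x, y) \<Rightarrow> nat (x * x) + nat (y * (y + 1))) =
        ?N (case p of (a, b) \<Rightarrow> (a + b, a - b - 1))"
      using pronic_nonneg[of b] pronic_nonneg[of "a + b"] pronic_nonneg[of "a - b - 1"]
      by (simp add: p nat_eq_iff algebra_simps flip: nat_add_distrib)
    show "(case p of (a, b) \<Rightarrow> w (of_int a + (of_int b + 1/2)) (of_int a - (of_int b + 1/2))) =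
        ?w (case p of (a, b) \<Rightarrow> (a + b, a - b - 1))"
      by (simp add: p algebra_simps)
  qed
  also have "gen_fun ?E ?N ?w = ?G"
    unfolding gen_fun_compose_X_power[OF zero_less_numeral]
  proof (rule gen_fun_bij[symmetric, where h = "\<lambda>(a, b). (a + b, b - a)"])
    show "bij_betw (\<lambda>(a::int, b). (a + b, b - a)) (UNIV \<times> UNIV) ?E"
      by (rule bij_betw_byWitness[where f' = "\<lambda>(u, v). ((u - v) div 2, (u + v) div 2)"])
        (auto, presburger+)
    fix p :: "int \<times> int"
    obtain a b where p: "p = (a, b)" by (cases p)
    show "2 * (case p of (x, y) \<Rightarrow> nat (x * x) + nat (y * (y + 1))) =
        ?N (case p of (a, b) \<Rightarrow> (a + b, b - a))"
      using pronic_nonneg[of b] pronic_nonneg[of "a + b"] pronic_nonneg[of "b - a"]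
      by (simp add: p nat_eq_iff algebra_simps flip: nat_add_distrib)
    show "(case p of (a, b) \<Rightarrow> w (of_int a + (of_int b + 1/2)) (of_int a - (of_int b + 1/2))) =
        ?w (case p of (a, b) \<Rightarrow> (a + b, b - a))"
      using w[of "of_int a + (of_int b + 1/2)" "of_int a - (of_int b + 1/2)"]
      by (simp add: p algebra_simps)
  qed
  finally show ?thesis by simp
qed

lemma half_theta_square: "half_theta 0 ^ 2 = 2 * ((half_theta 0 * int_theta 0) oo fps_X ^ 2)"
  using half_theta_pairs[of "\<lambda>_ _. 1"]
  by (simp add: power2_eq_square half_theta_def int_theta_def case_prod_unfold mult.commute
      gen_fun_mult[OF finite_fibres_half finite_fibres_half]
      gen_fun_mult[OF finite_fibres_int finite_fibres_half])

text \<open>The polynomial Re((s + it)^4) changes by the factor -4 under the rotation by 45 degrees,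
  scaled by the square root of 2, that maps Z x (Z + 1/2) into the pairs of half-integers.\<close>

lemma half_theta_quartic:
  "half_theta 0 * half_theta 4 - 3 * half_theta 2 ^ 2 =
    - 4 * ((int_theta 4 * half_theta 0 - 6 * int_theta 2 * half_theta 2 + int_theta 0 * half_theta 4) oo fps_X ^ 2)"
proof -
  let ?w = "\<lambda>s t::real. s ^ 4 + (-6) * (s ^ 2 * t ^ 2) + t ^ 4"
  note mults = gen_fun_mult[OF finite_fibres_half finite_fibres_half]
    gen_fun_mult[OF finite_fibres_int finite_fibres_half]
  have L: "gen_fun (UNIV \<times> UNIV) (\<lambda>(k::int, l::int). nat (k * (k + 1)) + nat (l * (l + 1)))
      (\<lambda>(k, l). ?w (of_int k + 1/2) (of_int l + 1/2)) =
      half_theta 4 * half_theta 0 + fps_const (-6) * (half_theta 2 * half_theta 2) + half_theta 0 * half_theta 4"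
    unfolding half_theta_def mults gen_fun_cmult[symmetric] gen_fun_add[symmetric]
    by (simp add: case_prod_unfold)
  have rot: "?w (a + h) (a - h) = - 4 * (a ^ 4 * h ^ 0 + - 6 * (a ^ 2 * h ^ 2) + a ^ 0 * h ^ 4)" for a h
    by (simp add: power4_eq_xxxx power2_eq_square algebra_simps)
  have R: "gen_fun (UNIV \<times> UNIV) (\<lambda>(a::int, b::int). nat (a * a) + nat (b * (b + 1)))
      (\<lambda>(a, b). ?w (of_int a + (of_int b + 1/2)) (of_int a - (of_int b + 1/2))) =
      fps_const (-4) * (int_theta 4 * half_theta 0 + fps_const (-6) * (int_theta 2 * half_theta 2)
        + int_theta 0 * half_theta 4)"
    unfolding half_theta_def int_theta_def mults gen_fun_cmult[symmetric] gen_fun_add[symmetric]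
    by (rule gen_fun_cong) (simp_all only: rot case_prod_unfold)
  have "half_theta 4 * half_theta 0 + fps_const (-6) * (half_theta 2 * half_theta 2) + half_theta 0 * half_theta 4 =
    2 * (fps_const (-4) * (int_theta 4 * half_theta 0 + fps_const (-6) * (int_theta 2 * half_theta 2)
        + int_theta 0 * half_theta 4) oo fps_X ^ 2)"
    using half_theta_pairs[of ?w] unfolding L R by simp
  moreover have "fps_const (-6 :: real) = - 6" "fps_const (-4 :: real) = - 4"
    by (simp_all add: numeral_fps_const)
  ultimately have "2 * (half_theta 0 * half_theta 4 - 3 * half_theta 2 ^ 2) = 2 * (
    - 4 * ((int_theta 4 * half_theta 0 - 6 * int_theta 2 * half_theta 2 + int_theta 0 * half_theta 4) oo fps_X ^ 2))"
    by (simp add: fps_compose_mult_distrib fps_compose_add_distrib fps_compose_sub_distrib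
        fps_compose_uminus algebra_simps power2_eq_square)
  then show ?thesis by (simp only: mult_cancel_left) simp
qed

section \<open>Jacobi and Halphen relations\<close>

lemmas compose_distribs = fps_compose_mult_distrib fps_compose_add_distrib fps_compose_sub_distrib
  fps_compose_uminus fps_compose_power[symmetric]

section \<open>The derivation q d/dq and the substitutions q -> -q and q -> q^2\<close>

lemma fps_XD_mult: "fps_XD (f * g) = fps_XD f * g + f * fps_XD g" for f g :: "real fps"
  by (simp add: fps_XD_def algebra_simps)

lemma fps_XD_X: "fps_XD fps_X = (fps_X :: real fps)"
  by (simp add: fps_XD_def)

lemma fps_XD_numeral: "fps_XD (numeral k) = (0 :: real fps)"
  by (simp add: fps_XD_def)

lemma fps_XD_uminus: "fps_XD (- f) = - fps_XD f" for f :: "real fps"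
  by (simp add: fps_XD_def)

lemma fps_XD_square: "fps_XD (f ^ 2) = 2 * f * fps_XD f" for f :: "real fps"
  by (simp add: power2_eq_square fps_XD_mult)

lemma fps_XD_power4: "fps_XD (f ^ 4) = 4 * f ^ 3 * fps_XD f" for f :: "real fps"
  by (simp add: fps_XD_def fps_deriv_power numeral_fps_const algebra_simps)

lemma fps_XD_diff: "fps_XD (f - g) = fps_XD f - fps_XD g" for f g :: "real fps"
  by (simp add: fps_XD_def algebra_simps)

lemma fps_XD_compose_X2: "fps_XD (f oo fps_X ^ 2) = 2 * (fps_XD f oo fps_X ^ 2)" for f :: "real fps"
  by (rule fps_ext) (auto simp: fps_compose_X_power_nth numeral_fps_const)

lemma fps_XD_compose_neg: "fps_XD (f oo - fps_X) = fps_XD f oo - fps_X" for f :: "real fps"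
  by (rule fps_ext) (simp add: fps_compose_uminus')

lemma fps_compose_neg_neg: "f oo - fps_X oo - fps_X = f" for f :: "real fps"
  by (rule fps_ext) (simp add: fps_compose_uminus')

lemma fps_compose_X2_neg: "f oo fps_X ^ 2 oo - fps_X = f oo fps_X ^ 2" for f :: "real fps"
  by (rule fps_ext) (auto simp: fps_compose_uminus' fps_compose_X_power_nth)

lemma fps_compose_X2_inject: "f oo fps_X ^ 2 = g oo fps_X ^ 2 \<longleftrightarrow> f = g" for f g :: "real fps"
proof
  assume *: "f oo fps_X ^ 2 = g oo fps_X ^ 2"
  show "f = g"
    by (rule fps_ext) (use arg_cong[OF *, of "\<lambda>h. h $ (2 * n)" for n] in \<open>simp add: fps_compose_X_power_nth\<close>)
qed simp

section \<open>Theta constants and their logarithmic derivatives\<close>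

abbreviation theta3 :: "real fps" where "theta3 \<equiv> int_theta 0"
abbreviation theta2 :: "real fps" where "theta2 \<equiv> half_theta 0"
definition theta4 :: "real fps" where "theta4 = theta3 oo - fps_X"

definition dlog2 :: "real fps" where "dlog2 = half_theta 2 * inverse theta2"
definition dlog3 :: "real fps" where "dlog3 = int_theta 2 * inverse theta3"
definition dlog4 :: "real fps" where "dlog4 = dlog3 oo - fps_X"

text \<open>In classical notation the theta constant theta2 carries a factor q^(1/4), which is omitted
  here to stay within power series in q; hence the factor X in tx, which is the fourth power of the
  classical constant, and the extra 1/4 in dlog2.\<close>

definition tx :: "real fps" where "tx = fps_X * theta2 ^ 4"
definition ty :: "real fps" where "ty = theta4 ^ 4"
definition tz :: "real fps" where "tz = theta3 ^ 4"

lemma theta3_nth: "theta3 $ n = real (card {k::int. k * k = int n})"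
  by (simp add: int_theta_def gen_fun_nth) (metis int_nat_eq zero_le_square nat_int)

lemma theta2_nth: "theta2 $ n = real (card {k::int. k * (k + 1) = int n})"
proof -
  have "nat (k * (k + 1)) = n \<longleftrightarrow> k * (k + 1) = int n" for k
    using pronic_nonneg[of k] by auto
  then show ?thesis by (simp add: half_theta_def gen_fun_nth)
qed

lemma theta3_nth_0: "theta3 $ 0 = 1"
  by (simp add: theta3_nth)

lemma theta2_nth_0: "theta2 $ 0 = 2"
proof -
  have "{k::int. k * (k + 1) = 0} = {0, -1}" by auto
  then show ?thesis by (simp add: theta2_nth)
qed

lemma theta2_nth_odd: "odd n \<Longrightarrow> theta2 $ n = 0"
proof -
  assume "odd n"
  then have "{k::int. k * (k + 1) = int n} = {}"
    by (auto, metis even_add even_mult_iff even_of_nat odd_one)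
  then show ?thesis by (simp add: theta2_nth)
qed

lemma theta2_neg: "theta2 oo - fps_X = theta2"
  by (rule fps_ext) (auto simp: fps_compose_uminus' theta2_nth_odd minus_one_power_iff)

lemma theta4_nth_0: "theta4 $ 0 = 1"
  by (simp add: theta4_def theta3_nth_0)

lemma theta_nonzero: "theta2 \<noteq> 0" "theta3 \<noteq> 0" "theta4 \<noteq> 0"
  using theta2_nth_0 theta3_nth_0 theta4_nth_0 by auto

lemma half_theta_2: "half_theta 2 = dlog2 * theta2"
  by (simp add: dlog2_def inverse_mult_eq_1 theta2_nth_0 mult.assoc)

lemma int_theta_2: "int_theta 2 = dlog3 * theta3"
  by (simp add: dlog3_def inverse_mult_eq_1 theta3_nth_0 mult.assoc)

lemma theta3_XD: "fps_XD theta3 = dlog3 * theta3"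
  using int_theta_XD[of 0] by (simp only: add_0 int_theta_2)

lemma theta4_XD: "fps_XD theta4 = dlog4 * theta4"
  by (simp add: theta4_def dlog4_def fps_XD_compose_neg theta3_XD fps_compose_mult_distrib)

lemma theta2_XD: "fps_XD theta2 = (dlog2 - fps_const (1/4)) * theta2"
  using half_theta_XD[of 0] by (simp only: add_0 half_theta_2 left_diff_distrib)

text \<open>The two terms with 1/4, in \<open>half_theta_XD\<close> and in \<open>theta2_XD\<close>,
  cancel. Ratios to \<open>theta2\<close> therefore obey the same recursion as ratios to
  \<open>theta3\<close>.\<close>

lemma half_theta_Suc_Suc:
  assumes "half_theta j = g * theta2"
  shows "half_theta (j + 2) = (fps_XD g + g * dlog2) * theta2"
proof -
  have "half_theta (j + 2) = fps_XD (half_theta j) + fps_const (1/4) * half_theta j"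
    using half_theta_XD[of j] by simp
  then show ?thesis using assms by (simp add: fps_XD_mult theta2_XD algebra_simps)
qed

lemma int_theta_Suc_Suc:
  assumes "int_theta j = g * theta3"
  shows "int_theta (j + 2) = (fps_XD g + g * dlog3) * theta3"
  using int_theta_XD[of j, symmetric] assms by (simp add: fps_XD_mult theta3_XD algebra_simps)

lemma half_theta_4: "half_theta 4 = (fps_XD dlog2 + dlog2 ^ 2) * theta2"
  using half_theta_Suc_Suc[OF half_theta_2] by (simp add: power2_eq_square)

lemma int_theta_4: "int_theta 4 = (fps_XD dlog3 + dlog3 ^ 2) * theta3"
  using int_theta_Suc_Suc[OF int_theta_2] by (simp add: power2_eq_square)

lemma half_theta_6:
  "half_theta 6 = (fps_XD (fps_XD dlog2) + 3 * dlog2 * fps_XD dlog2 + dlog2 ^ 3) * theta2"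
  using half_theta_Suc_Suc[OF half_theta_4]
  by (simp add: fps_XD_mult power2_eq_square power3_eq_cube algebra_simps)

lemma int_theta_6:
  "int_theta 6 = (fps_XD (fps_XD dlog3) + 3 * dlog3 * fps_XD dlog3 + dlog3 ^ 3) * theta3"
  using int_theta_Suc_Suc[OF int_theta_4]
  by (simp add: fps_XD_mult power2_eq_square power3_eq_cube algebra_simps)

lemma t_XD: "fps_XD tx = 4 * dlog2 * tx" "fps_XD ty = 4 * dlog4 * ty" "fps_XD tz = 4 * dlog3 * tz"
proof -
  \<comment> \<open>The factor \<open>fps_X\<close> of \<open>tx\<close> adds 1 to the logarithmic
    derivative, which cancels four times the 1/4 of \<open>theta2_XD\<close>.\<close>
  have c: "fps_const (1/4 :: real) * 4 = 1"
    by (simp add: numeral_fps_const flip: fps_const_1_eq_1)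
  have "fps_XD tx = 4 * dlog2 * tx + (1 - fps_const (1/4) * 4) * tx"
    by (simp add: theta2_XD tx_def fps_XD_mult fps_XD_power4 fps_XD_X power4_eq_xxxx power3_eq_cube algebra_simps)
  then show "fps_XD tx = 4 * dlog2 * tx" by (simp add: c)
  show "fps_XD ty = 4 * dlog4 * ty" "fps_XD tz = 4 * dlog3 * tz"
    by (simp_all add: ty_def tz_def fps_XD_power4 theta3_XD theta4_XD)
      (simp_all add: power4_eq_xxxx power3_eq_cube)
qed

section \<open>Doubling formulas and Jacobi's identity\<close>

lemma theta3_square: "theta3 ^ 2 = (theta3 oo fps_X ^ 2) ^ 2 + fps_X * (theta2 oo fps_X ^ 2) ^ 2"
  by (rule int_theta_square)

lemma theta4_square: "theta4 ^ 2 = (theta3 oo fps_X ^ 2) ^ 2 - fps_X * (theta2 oo fps_X ^ 2) ^ 2"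
proof -
  have "theta4 ^ 2 = theta3 ^ 2 oo - fps_X" by (simp add: theta4_def fps_compose_power)
  then show ?thesis
    unfolding theta3_square by (simp add: compose_distribs fps_compose_X2_neg)
qed

lemma theta2_square: "theta2 ^ 2 = 2 * (theta2 oo fps_X ^ 2) * (theta3 oo fps_X ^ 2)"
  using half_theta_square by (simp add: compose_distribs)

text \<open>If A and B are the two terms in \<open>theta3_square\<close>, this is (A + B)^2 - (A -
  B)^2 = 4 A B, and \<open>theta2_square\<close> identifies 4 A B with \<open>tx\<close>.\<close>

lemma jacobi: "tz = tx + ty"
proof -
  have *: "tz = (theta3 ^ 2) ^ 2" "ty = (theta4 ^ 2) ^ 2" "tx = fps_X * (theta2 ^ 2) ^ 2"
    by (simp_all add: tx_def ty_def tz_def flip: power_mult)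
  show ?thesis
    unfolding * theta3_square theta4_square theta2_square by (simp add: power2_eq_square algebra_simps)
qed

lemma t_neg: "tx oo - fps_X = - tx" "ty oo - fps_X = tz" "tz oo - fps_X = ty"
  by (simp_all add: tx_def ty_def tz_def theta4_def compose_distribs fps_compose_neg_neg theta2_neg)

lemma theta34: "theta3 * theta4 = (theta4 oo fps_X ^ 2) ^ 2"
proof -
  have "(theta3 * theta4) ^ 2 = (tz - tx) oo fps_X ^ 2"
    by (simp add: power_mult_distrib theta3_square theta4_square tz_def tx_def compose_distribs)
      (simp add: power2_eq_square power4_eq_xxxx algebra_simps)
  also have "\<dots> = ((theta4 oo fps_X ^ 2) ^ 2) ^ 2"
    by (simp add: jacobi ty_def compose_distribs flip: power_mult)
  \<comment> \<open>So far only the squares agree; the constant coefficients 1 and -1 decide the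
    sign.\<close>
  finally have "theta3 * theta4 = (theta4 oo fps_X ^ 2) ^ 2 \<or> theta3 * theta4 = - ((theta4 oo fps_X ^ 2) ^ 2)"
    by (simp only: power2_eq_iff)
  moreover have "(theta3 * theta4) $ 0 \<noteq> (- ((theta4 oo fps_X ^ 2) ^ 2)) $ 0"
    by (simp add: theta3_nth_0 theta4_nth_0 power2_eq_square)
  ultimately show ?thesis by metis
qed

lemma tx_square: "tx ^ 2 = 16 * ((tx * tz) oo fps_X ^ 2)"
proof -
  have "tx ^ 2 = fps_X ^ 2 * (theta2 ^ 2) ^ 4" by (simp add: tx_def power_mult_distrib flip: power_mult)
  then show ?thesis by (simp add: theta2_square tx_def tz_def compose_distribs power_mult_distrib)
qed

lemma ty_tz_mult: "ty * tz = ty ^ 2 oo fps_X ^ 2"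
proof -
  have "ty * tz = (theta3 * theta4) ^ 4" by (simp add: ty_def tz_def power_mult_distrib)
  then show ?thesis by (simp add: theta34 ty_def compose_distribs flip: power_mult)
qed

lemma ty_tz_add: "ty + tz = 2 * ((tx + tz) oo fps_X ^ 2)"
proof -
  have "ty + tz = (theta4 ^ 2) ^ 2 + (theta3 ^ 2) ^ 2" by (simp add: ty_def tz_def flip: power_mult)
  then show ?thesis
    by (simp add: theta3_square theta4_square tx_def tz_def compose_distribs)
      (simp add: power2_eq_square power4_eq_xxxx algebra_simps)
qed

lemma t_nonzero: "tx \<noteq> 0" "ty \<noteq> 0" "tz \<noteq> 0"
  using theta_nonzero by (simp_all add: tx_def ty_def tz_def)

section \<open>The Halphen relations and their solution\<close>

lemma jacobi_XD: "tx * (dlog2 - dlog3) = ty * (dlog3 - dlog4)"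
proof -
  have "4 * dlog3 * (tx + ty) = 4 * dlog2 * tx + 4 * dlog4 * ty"
    using arg_cong[OF jacobi, of fps_XD] by (simp only: t_XD fps_XD_add) (simp only: jacobi)
  then have "4 * (tx * (dlog2 - dlog3)) = 4 * (ty * (dlog3 - dlog4))"
    by (simp only: algebra_simps)
  then show ?thesis by (simp only: mult_cancel_left) simp
qed

text \<open>Logarithmic derivative of \<open>theta2_square\<close>. The square on the left and the
  substitution q -> q^2 on the right both double the 1/4, so it drops out.\<close>

lemma dlog2_double: "dlog2 = (dlog2 + dlog3) oo fps_X ^ 2"
proof -
  let ?S = "\<lambda>f::real fps. f oo fps_X ^ 2"
  have "2 * (dlog2 - fps_const (1/4)) * theta2 ^ 2 = fps_XD (theta2 ^ 2)"
    by (simp add: fps_XD_square theta2_XD) (simp add: power2_eq_square algebra_simps)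
  also have "\<dots> = 2 * (?S (dlog2 + dlog3) - fps_const (1/4)) * (2 * (?S theta2 * ?S theta3))"
    by (simp add: half_theta_square fps_XD_mult fps_XD_numeral fps_XD_compose_X2 theta2_XD theta3_XD compose_distribs
        algebra_simps)
  also have "2 * (?S theta2 * ?S theta3) = theta2 ^ 2" by (simp add: theta2_square)
  finally have "(2 * theta2 ^ 2) * (dlog2 - fps_const (1/4)) =
      (2 * theta2 ^ 2) * (?S (dlog2 + dlog3) - fps_const (1/4))" by (simp only: ac_simps)
  then show ?thesis using theta_nonzero by simp
qed

text \<open>Dividing \<open>half_theta_quartic\<close> by \<open>theta2 ^ 2\<close> links
  \<open>dlog2\<close> at q with \<open>dlog2\<close> and \<open>dlog3\<close> at q^2. By
  \<open>dlog2_double\<close> and its derivative the left side also lives at q^2, and the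
  substitution can then be removed by injectivity.\<close>

lemma halphen23: "fps_XD dlog2 + fps_XD dlog3 = 4 * dlog2 * dlog3"
proof -
  let ?S = "\<lambda>f::real fps. f oo fps_X ^ 2"
  let ?Q = "fps_XD dlog3 + dlog3 ^ 2 - 6 * dlog2 * dlog3 + fps_XD dlog2 + dlog2 ^ 2"
  have "theta2 ^ 2 * (fps_XD dlog2 - 2 * dlog2 ^ 2) = half_theta 0 * half_theta 4 - 3 * half_theta 2 ^ 2"
    by (simp add: half_theta_2 half_theta_4 power2_eq_square algebra_simps)
  also have "\<dots> = - 2 * (2 * (?S theta2 * ?S theta3)) * ?S ?Q"
    unfolding half_theta_quartic
    by (simp add: half_theta_2 half_theta_4 int_theta_2 int_theta_4 compose_distribs algebra_simps)
  also have "2 * (?S theta2 * ?S theta3) = theta2 ^ 2" by (simp add: theta2_square)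
  finally have "theta2 ^ 2 * (fps_XD dlog2 - 2 * dlog2 ^ 2) = theta2 ^ 2 * (- 2 * ?S ?Q)"
    by (simp only: ac_simps)
  then have "fps_XD dlog2 - 2 * dlog2 ^ 2 = - 2 * ?S ?Q"
    using theta_nonzero by (simp only: mult_cancel_left) simp
  moreover have "fps_XD dlog2 = 2 * ?S (fps_XD dlog2 + fps_XD dlog3)"
    using arg_cong[OF dlog2_double, of fps_XD] by (simp add: fps_XD_compose_X2)
  moreover have "dlog2 ^ 2 = ?S ((dlog2 + dlog3) ^ 2)"
    by (subst dlog2_double) (simp add: compose_distribs)
  ultimately have "2 * ?S (fps_XD dlog2 + fps_XD dlog3) - 2 * ?S ((dlog2 + dlog3) ^ 2) = - 2 * ?S ?Q"
    by simp
  then have "?S (2 * (fps_XD dlog2 + fps_XD dlog3) - 2 * (dlog2 + dlog3) ^ 2) = ?S (- 2 * ?Q)"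
    by (simp add: compose_distribs)
  then have "2 * (fps_XD dlog2 + fps_XD dlog3) - 2 * (dlog2 + dlog3) ^ 2 = - 2 * ?Q"
    by (simp only: fps_compose_X2_inject)
  then have "4 * (fps_XD dlog2 + fps_XD dlog3) = 4 * (4 * dlog2 * dlog3)"
    by (simp add: power2_eq_square algebra_simps)
  then show ?thesis by (simp only: mult_cancel_left) simp
qed

lemma dlog2_neg: "dlog2 oo - fps_X = dlog2"
proof -
  have "((dlog2 oo - fps_X) - fps_const (1/4)) * theta2 = fps_XD theta2 oo - fps_X"
    by (simp add: theta2_XD compose_distribs theta2_neg)
  also have "\<dots> = (dlog2 - fps_const (1/4)) * theta2"
    by (metis fps_XD_compose_neg theta2_neg theta2_XD)
  finally show ?thesis using theta_nonzero by simp
qed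

lemma halphen24: "fps_XD dlog2 + fps_XD dlog4 = 4 * dlog2 * dlog4"
  using arg_cong[OF halphen23, of "\<lambda>f. f oo - fps_X"]
  by (simp add: compose_distribs dlog2_neg dlog4_def fps_XD_compose_neg flip: fps_XD_compose_neg)

lemma dlog_nth_0: "dlog2 $ 0 = 1/4" "dlog3 $ 0 = 0" "dlog4 $ 0 = 0"
proof -
  show "dlog2 $ 0 = 1/4"
    using arg_cong[OF theta2_XD, of "\<lambda>f. f $ 0"] by (simp add: theta2_nth_0)
  show d3: "dlog3 $ 0 = 0"
    using arg_cong[OF theta3_XD, of "\<lambda>f. f $ 0"] by (simp add: theta3_nth_0)
  then show "dlog4 $ 0 = 0" by (simp add: dlog4_def)
qed

lemma dlog_diff_cross: "tz * (dlog2 - dlog3) = ty * (dlog2 - dlog4)"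
  using jacobi_XD by (simp add: jacobi algebra_simps)

text \<open>\<open>halphen23\<close> and \<open>halphen24\<close> are two equations for three
  derivatives; differentiating \<open>dlog_diff_cross\<close> supplies the missing one. After
  multiplication by b, the relation itself lets \<open>tz\<close> cancel, leaving a linear equation
  for the derivative of \<open>dlog2\<close>.\<close>

lemma dlog2_XD: "fps_XD dlog2 = 2 * dlog2 ^ 2 - 2 * (dlog2 - dlog3) * (dlog2 - dlog4)"
proof -
  define a where "a = dlog2 - dlog3"
  define b where "b = dlog2 - dlog4"
  have ab: "tz * a = ty * b" using dlog_diff_cross by (simp add: a_def b_def)
  \<comment> \<open>The constant coefficient of a is 1/4. Through \<open>jacobi_XD\<close> this
    makes \<open>dlog3 - dlog4\<close> nonzero, the factor divided out at the end.\<close>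
  have "a \<noteq> 0" using dlog_nth_0 by (auto simp: a_def fps_eq_iff intro!: exI[of _ 0])
  then have ne: "dlog3 - dlog4 \<noteq> 0" using jacobi_XD t_nonzero by (auto simp: a_def)
  have "tz * (4 * dlog3 * a + fps_XD a) = ty * (4 * dlog4 * b + fps_XD b)"
    using arg_cong[OF ab, of fps_XD] by (simp add: fps_XD_mult t_XD algebra_simps)
  then have "b * (tz * (4 * dlog3 * a + fps_XD a)) = b * (ty * (4 * dlog4 * b + fps_XD b))"
    by (rule arg_cong)
  then have "tz * (b * (4 * dlog3 * a + fps_XD a)) = (ty * b) * (4 * dlog4 * b + fps_XD b)"
    by (simp only: ac_simps)
  also have "\<dots> = tz * (a * (4 * dlog4 * b + fps_XD b))" by (simp flip: ab)
  finally have "b * (4 * dlog3 * a + fps_XD a) = a * (4 * dlog4 * b + fps_XD b)"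
    using t_nonzero by (simp only: mult_cancel_left) simp
  moreover have XD: "fps_XD a = 2 * fps_XD dlog2 - 4 * dlog2 * dlog3"
      "fps_XD b = 2 * fps_XD dlog2 - 4 * dlog2 * dlog4"
    by (simp_all add: a_def b_def fps_XD_diff flip: halphen23 halphen24)
  ultimately have "(2 * (dlog3 - dlog4)) * fps_XD dlog2 =
      (2 * (dlog3 - dlog4)) * (2 * dlog2 ^ 2 - 2 * a * b)"
    unfolding XD by (simp add: a_def b_def power2_eq_square algebra_simps)
  then show ?thesis using ne unfolding a_def b_def by (simp only: mult_cancel_left) simp
qed

text \<open>The difference and \<open>ty\<close> both solve u' = 4 \<open>dlog4\<close> u, so their
  quotient g has derivative 0 and equals its constant coefficient 1/4.\<close>

lemma dlog2_minus_dlog3: "4 * (dlog2 - dlog3) = ty"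
proof -
  define g where "g = (dlog2 - dlog3) * inverse ty"
  have y0: "ty $ 0 = 1" by (simp add: ty_def fps_nth_power_0 theta4_nth_0)
  have g: "dlog2 - dlog3 = g * ty" by (simp add: g_def inverse_mult_eq_1 y0 mult.assoc)
  have "fps_XD (dlog2 - dlog3) = 2 * fps_XD dlog2 - 4 * dlog2 * dlog3"
    by (simp add: fps_XD_diff flip: halphen23)
  also have "\<dots> = 4 * dlog4 * (dlog2 - dlog3)"
    unfolding dlog2_XD by (simp add: power2_eq_square algebra_simps)
  finally have "fps_XD g * ty = 0" unfolding g by (simp add: fps_XD_mult t_XD algebra_simps)
  then have "fps_XD g = 0" using t_nonzero by simp
  then have g0: "real n * g $ n = 0" for n by (metis fps_XD_nth fps_zero_nth)
  have "g $ 0 = 1/4"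
    using arg_cong[OF g, of "\<lambda>f. f $ 0"] by (simp add: dlog_nth_0 y0)
  then have "g $ n = fps_const (1/4) $ n" for n using g0[of n] by (cases n) auto
  then have "g = fps_const (1/4)" by (rule fps_ext)
  then show ?thesis by (simp add: g numeral_fps_const flip: mult.assoc)
qed

lemma dlog2_minus_dlog4: "4 * (dlog2 - dlog4) = tz"
proof -
  have "ty * (4 * (dlog2 - dlog4)) = 4 * (dlog2 - dlog3) * tz"
    using arg_cong[OF dlog_diff_cross, of "(*) 4"] by (simp only: ac_simps)
  then show ?thesis using t_nonzero unfolding dlog2_minus_dlog3 by (simp only: mult_cancel_left) simp
qed

section \<open>The quartic and sextic expressions in terms of theta constants\<close>

lemma dlog2_quartic: "8 * (fps_XD dlog2 - 2 * dlog2 ^ 2) = - (ty * tz)"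
  unfolding dlog2_XD dlog2_minus_dlog3[symmetric] dlog2_minus_dlog4[symmetric]
  by (simp add: algebra_simps)

lemma dlog3_quartic: "8 * (fps_XD dlog3 - 2 * dlog3 ^ 2) = tx * ty"
proof -
  have x: "tx = tz - ty" unfolding jacobi by simp
  have d3: "fps_XD dlog3 = 4 * dlog2 * dlog3 - fps_XD dlog2" using halphen23 by (simp add: algebra_simps)
  show ?thesis
    unfolding x d3 dlog2_XD dlog2_minus_dlog3[symmetric] dlog2_minus_dlog4[symmetric]
    by (simp add: algebra_simps power2_eq_square)
qed

text \<open>For E = f' - 2 f^2 the sextic expression is E' - 8 f E. Here E is a multiple of
  \<open>ty * tz\<close>, with logarithmic derivative 4 (\<open>dlog3\<close> +
  \<open>dlog4\<close>), so only the two known differences remain.\<close>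

lemma dlog2_sextic:
  "8 * (fps_XD (fps_XD dlog2) - 12 * dlog2 * fps_XD dlog2 + 16 * dlog2 ^ 3) = ty * tz * (ty + tz)"
proof -
  have "8 * (fps_XD (fps_XD dlog2) - 12 * dlog2 * fps_XD dlog2 + 16 * dlog2 ^ 3) =
      fps_XD (8 * (fps_XD dlog2 - 2 * dlog2 ^ 2)) - 8 * dlog2 * (8 * (fps_XD dlog2 - 2 * dlog2 ^ 2))"
    by (simp add: fps_XD_diff fps_XD_square numeral_fps_const)
      (simp add: algebra_simps power3_eq_cube power2_eq_square flip: numeral_fps_const)
  also have "\<dots> = ty * tz * (4 * (dlog2 - dlog3) + 4 * (dlog2 - dlog4))"
    unfolding dlog2_quartic by (simp add: fps_XD_uminus fps_XD_mult t_XD algebra_simps)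
  finally show ?thesis by (simp only: dlog2_minus_dlog3 dlog2_minus_dlog4)
qed

lemma dlog3_sextic:
  "8 * (fps_XD (fps_XD dlog3) - 12 * dlog3 * fps_XD dlog3 + 16 * dlog3 ^ 3) = tx * ty * (ty - tx)"
proof -
  have "8 * (fps_XD (fps_XD dlog3) - 12 * dlog3 * fps_XD dlog3 + 16 * dlog3 ^ 3) =
      fps_XD (8 * (fps_XD dlog3 - 2 * dlog3 ^ 2)) - 8 * dlog3 * (8 * (fps_XD dlog3 - 2 * dlog3 ^ 2))"
    by (simp add: fps_XD_diff fps_XD_square numeral_fps_const)
      (simp add: algebra_simps power3_eq_cube power2_eq_square flip: numeral_fps_const)
  \<comment> \<open>The factor 4 (\<open>dlog2\<close> + \<open>dlog4\<close>) - 8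
    \<open>dlog3\<close>, regrouped into the two known differences.\<close>
  also have "\<dots> = tx * ty * (2 * (4 * (dlog2 - dlog3)) - 4 * (dlog2 - dlog4))"
    unfolding dlog3_quartic by (simp add: fps_XD_mult t_XD algebra_simps)
  also have "\<dots> = tx * ty * (ty - tx)"
    unfolding dlog2_minus_dlog3 dlog2_minus_dlog4 jacobi by (simp add: algebra_simps)
  finally show ?thesis .
qed

section \<open>Vanishing coefficients\<close>

text \<open>f(q) + f(-q) is twice the even part of f, so this computes the operator U(2), which
  keeps the even exponents and halves them.\<close>

lemma nth_even_part:
  fixes f g :: "real fps"
  assumes "f + (f oo - fps_X) = g oo fps_X ^ 2"
  shows "2 * f $ (2 * n) = g $ n"
  using arg_cong[OF assms, of "\<lambda>h. h $ (2 * n)"]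
  by (simp add: fps_compose_uminus' fps_compose_X_power_nth)

lemma nth_odd_eq_0:
  fixes f :: "real fps"
  assumes "f oo - fps_X = f" "odd n"
  shows "f $ n = 0"
  using arg_cong[OF assms(1), of "\<lambda>h. h $ n"] assms(2) by (simp add: fps_compose_uminus')

lemma nth_even_eq_0:
  fixes f :: "real fps"
  assumes "f oo - fps_X = - f"
  shows "f $ (2 * n) = 0"
  using arg_cong[OF assms(1), of "\<lambda>h. h $ (2 * n)"] by (simp add: fps_compose_uminus')

section \<open>Dimensions 4 and 16\<close>

lemma txyz_neg: "tx * ty * tz oo - fps_X = - (tx * ty * tz)"
  by (simp add: compose_distribs t_neg)

lemma txyz_nth_even: "(tx * ty * tz) $ (2 * n) = 0"
  by (rule nth_even_eq_0[OF txyz_neg])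

text \<open>The doubling formulas give 256 (\<open>tx * ty * tz\<close>)^2 at q^2. The square of an
  odd series is even, so only exponents divisible by 4 occur.\<close>

lemma shadow16_quartic_nth: "(tx ^ 4 * (ty * tz)) $ (4 * a + 2) = 0"
proof -
  have e: "(tx * ty * tz) ^ 2 oo - fps_X = (tx * ty * tz) ^ 2"
    by (simp add: compose_distribs t_neg power_mult_distrib mult_ac)
  have "tx ^ 4 * (ty * tz) = (tx ^ 2) ^ 2 * (ty * tz)" by (simp flip: power_mult)
  also have "\<dots> = 256 * ((tx * ty * tz) ^ 2 oo fps_X ^ 2)"
    unfolding tx_square ty_tz_mult by (simp add: compose_distribs power_mult_distrib)
  finally have *: "tx ^ 4 * (ty * tz) = 256 * ((tx * ty * tz) ^ 2 oo fps_X ^ 2)" .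
  have "(tx ^ 4 * (ty * tz)) $ (2 * (2 * a + 1)) = 256 * ((tx * ty * tz) ^ 2) $ (2 * a + 1)"
    unfolding * by (simp add: numeral_fps_const fps_compose_X_power_nth)
  then show ?thesis using nth_odd_eq_0[OF e] by (simp add: algebra_simps)
qed

text \<open>Up to a scalar this is the difference of the two newforms of weight 14 and level 2, whose
  eigenvalues under U(2) are 64 and -64; hence U(4) acts on it as multiplication by 4096.\<close>

definition hecke_form :: "real fps" where
  "hecke_form = (tx * ty * tz) ^ 2 * (tx + tz)"

lemma half_sextic_double: "tx ^ 4 * ty * tz * (ty + tz) = 512 * hecke_form oo fps_X ^ 2"
proof -
  have *: "tx ^ 4 * ty * tz * (ty + tz) = (tx ^ 2) ^ 2 * (ty * tz) * (ty + tz)"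
    by (simp add: mult.assoc flip: power_mult)
  show ?thesis
    unfolding * unfolding tx_square ty_tz_mult ty_tz_add hecke_form_def
    by (simp add: compose_distribs power_mult_distrib algebra_simps)
qed

text \<open>U(4) is taken as U(2) twice: U(2) sends \<open>hecke_form\<close> to 16 K and K to 256
  \<open>hecke_form\<close>, and 16 * 256 = 4096.\<close>

lemma hecke_form_nth: "hecke_form $ (4 * n) = 4096 * hecke_form $ n"
proof -
  define K where "K = tx * ty ^ 4 * tz * (tx + tz)"
  have "hecke_form + (hecke_form oo - fps_X) = tx ^ 2 * (ty * tz) ^ 2 * (ty + tz)"
    by (simp add: hecke_form_def compose_distribs t_neg)
      (simp add: algebra_simps power2_eq_square)
  also have "\<dots> = 32 * K oo fps_X ^ 2"
    unfolding tx_square ty_tz_mult ty_tz_add K_def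
    by (simp add: compose_distribs power_mult_distrib flip: power_mult)
  finally have 1: "2 * hecke_form $ (2 * m) = 32 * K $ m" for m
    using nth_even_part[of hecke_form "32 * K" m] by (simp add: numeral_fps_const)
  have "K + (K oo - fps_X) = tx * ty * tz * (ty ^ 3 * (tx + tz) - tz ^ 3 * (ty - tx))"
    by (simp add: K_def compose_distribs t_neg) (simp add: algebra_simps eval_nat_numeral)
  also have "ty ^ 3 * (tx + tz) - tz ^ 3 * (ty - tx) = tx ^ 3 * (ty + tz)"
    unfolding jacobi by (simp add: algebra_simps eval_nat_numeral)
  also have "tx * ty * tz * (tx ^ 3 * (ty + tz)) = 512 * hecke_form oo fps_X ^ 2"
    unfolding half_sextic_double[symmetric] by (simp add: algebra_simps eval_nat_numeral)
  finally have 2: "2 * K $ (2 * m) = 512 * hecke_form $ m" for m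
    using nth_even_part[of K "512 * hecke_form" m] by (simp add: numeral_fps_const)
  show ?thesis using 1[of "2 * n"] 2[of n] by simp
qed

text \<open>The expansion starts at q^2, so the coefficient of q is 0; the eigenvalue relation
  carries this to all powers of 4.\<close>

lemma hecke_form_nth_4_power: "hecke_form $ (4 ^ a) = 0"
proof (induction a)
  case 0
  have *: "hecke_form = fps_X ^ 2 * (theta2 ^ 8 * (ty * tz) ^ 2 * (tx + tz))"
    by (simp add: hecke_form_def power_mult_distrib) (simp add: tx_def power_mult_distrib flip: power_mult)
  show ?case unfolding * by (simp add: fps_X_power_mult_nth)
next
  case (Suc a)
  then show ?case by (simp add: hecke_form_nth)
qed

lemma half_sextic_nth: "(tx ^ 4 * (ty * tz * (ty + tz))) $ (2 * 4 ^ a) = 0"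
proof -
  have "tx ^ 4 * (ty * tz * (ty + tz)) = 512 * hecke_form oo fps_X ^ 2"
    using half_sextic_double by (simp only: mult.assoc)
  then show ?thesis
    using hecke_form_nth_4_power[of a] by (simp add: fps_compose_X_power_nth numeral_fps_const)
qed

text \<open>For this lattice series f, f(q) + f(-q) is minus the shadow series of
  \<open>half_sextic_double\<close>, so the same coefficients of \<open>hecke_form\<close> decide
  both cases.\<close>

lemma int_sextic_nth: "(tz ^ 4 * (tx * ty * (ty - tx))) $ (2 * 4 ^ a) = 0"
proof -
  let ?f = "tz ^ 4 * (tx * ty * (ty - tx))"
  have "?f + (?f oo - fps_X) = - (tx ^ 4 * ty * tz * (ty + tz))"
    by (simp add: compose_distribs t_neg) (simp add: jacobi algebra_simps eval_nat_numeral)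
  also have "\<dots> = (- (512 * hecke_form)) oo fps_X ^ 2"
    unfolding half_sextic_double by (simp add: compose_distribs)
  finally have "2 * ?f $ (2 * 4 ^ a) = (- (512 * hecke_form)) $ (4 ^ a)" by (rule nth_even_part)
  then show ?thesis using hecke_form_nth_4_power[of a] by (simp add: numeral_fps_const)
qed

section \<open>Dimension 7\<close>

definition seven_form :: "real fps" where
  "seven_form = theta3 ^ 7 * (tx * ty)"

text \<open>Writing \<open>theta3\<close> = A + B and \<open>theta4\<close> = A - B by parity, A is
  a series in q^4 and B is q times one, so powers of B sort the exponents modulo 4. The product (A +
  B)^6 (A - B)^3 has no terms A^7 B^2 and A^2 B^7. After the factor A B this removes B^3 and B^8,
  and the residues 0 and 3 retain one term each, j = 4 and j = 7.\<close>

lemma seven_form_expand: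
  defines "Q \<equiv> \<lambda>j f. fps_X ^ j * (f oo fps_X ^ 4)"
  shows "seven_form =
    Q 1 (8 * theta3 ^ 10 * ty * theta2) + Q 2 (24 * theta3 ^ 9 * ty * theta2 ^ 2)
    - Q 4 (64 * theta3 ^ 7 * ty * theta2 ^ 4) - Q 5 (48 * theta3 ^ 6 * ty * theta2 ^ 5)
    + Q 6 (48 * theta3 ^ 5 * ty * theta2 ^ 6) + Q 7 (64 * theta3 ^ 4 * ty * theta2 ^ 7)
    - Q 9 (24 * theta3 ^ 2 * ty * theta2 ^ 9) - Q 10 (8 * theta3 * ty * theta2 ^ 10)"
proof -
  define A where "A = theta3 oo fps_X ^ 4"
  define T where "T = theta2 oo fps_X ^ 4"
  define B where "B = fps_X * T"
  have t3: "theta3 = A + B" using int_theta_split by (simp add: A_def B_def T_def)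
  have neg4: "f oo fps_X ^ 4 oo - fps_X = f oo fps_X ^ 4" for f :: "real fps"
    by (rule fps_ext) (auto simp: fps_compose_uminus' fps_compose_X_power_nth minus_one_power_iff)
  have t4: "theta4 = A - B"
    unfolding theta4_def t3 by (simp add: A_def B_def T_def compose_distribs neg4)
  have C: "ty oo fps_X ^ 4 = A ^ 4 - B ^ 4"
  proof -
    have *: "ty = tz - tx" unfolding jacobi by simp
    show ?thesis
      unfolding * by (simp add: A_def B_def T_def tz_def tx_def compose_distribs power_mult_distrib)
  qed
  define Y where "Y = ty oo fps_X ^ 4"
  have "tx * ty = ((A + B) ^ 4 - (A - B) ^ 4) * (A - B) ^ 4"
  proof -
    have *: "tx = tz - ty" unfolding jacobi by simp
    show ?thesis unfolding * by (simp add: tz_def ty_def t3 t4)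
  qed
  then have "seven_form = (A + B) ^ 7 * (((A + B) ^ 4 - (A - B) ^ 4) * (A - B) ^ 4)"
    by (simp only: seven_form_def t3)
  \<comment> \<open>A^4 - B^4 is split off because it is \<open>ty\<close> at q^4 and does not mix
    residues modulo 4.\<close>
  also have "\<dots> = 8 * A * B * (A ^ 4 - B ^ 4) * ((A + B) ^ 6 * (A - B) ^ 3)"
  proof -
    have "(A + B) ^ 4 - (A - B) ^ 4 = 8 * A * B * (A ^ 2 + B ^ 2)"
      "(A ^ 4 - B ^ 4) = (A ^ 2 + B ^ 2) * (A + B) * (A - B)"
      by (simp_all add: algebra_simps eval_nat_numeral)
    then show ?thesis by (simp only:) (simp add: eval_nat_numeral mult_ac)
  qed
  also have "(A + B) ^ 6 * (A - B) ^ 3 = (A + B) ^ 3 * (A ^ 2 - B ^ 2) ^ 3"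
    by (simp add: algebra_simps eval_nat_numeral)
  also have "\<dots> = A ^ 9 + 3 * A ^ 8 * B - 8 * A ^ 6 * B ^ 3 - 6 * A ^ 5 * B ^ 4 + 6 * A ^ 4 * B ^ 5
      + 8 * A ^ 3 * B ^ 6 - 3 * A * B ^ 8 - B ^ 9"
    by (simp add: algebra_simps eval_nat_numeral)
  also have "A ^ 4 - B ^ 4 = Y" by (simp add: Y_def C)
  finally have "seven_form = 8 * A * B * Y * (A ^ 9 + 3 * A ^ 8 * B - 8 * A ^ 6 * B ^ 3 - 6 * A ^ 5 * B ^ 4 + 6 * A ^ 4 * B ^ 5
      + 8 * A ^ 3 * B ^ 6 - 3 * A * B ^ 8 - B ^ 9)" .
  then show ?thesis
    by (simp add: Q_def compose_distribs flip: A_def T_def Y_def)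
      (simp add: B_def algebra_simps eval_nat_numeral)
qed

lemma X_power_mult_compose_nth:
  fixes f :: "real fps"
  shows "(fps_X ^ j * (f oo fps_X ^ 4)) $ n = (if j \<le> n \<and> 4 dvd n - j then f $ ((n - j) div 4) else 0)"
  by (simp add: fps_X_power_mult_nth fps_compose_X_power_nth)

lemma X_power_mult_compose_nth_eq_0:
  fixes f :: "real fps"
  assumes "n mod 4 \<noteq> j mod 4"
  shows "(fps_X ^ j * (f oo fps_X ^ 4)) $ n = 0"
  using assms by (auto simp: X_power_mult_compose_nth mod_eq_dvd_iff_nat)

lemma X_mult_compose_nth_eq_0:
  fixes f :: "real fps"
  assumes "n mod 4 \<noteq> 1"
  shows "(fps_X * (f oo fps_X ^ 4)) $ n = 0"
  using X_power_mult_compose_nth_eq_0[of n 1 f] assms by simp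

text \<open>In residue 0 only j = 4 remains, and q^4 times \<open>theta2 ^ 4\<close> at q^4 is
  \<open>tx\<close> at q^4: the form reproduces itself with factor -64.\<close>

lemma seven_form_nth_4: "seven_form $ (4 * n) = - 64 * seven_form $ n"
proof -
  have "seven_form $ (4 * n) = - (fps_X ^ 4 * ((64 * theta3 ^ 7 * ty * theta2 ^ 4) oo fps_X ^ 4)) $ (4 * n)"
    unfolding seven_form_expand by (simp add: X_power_mult_compose_nth_eq_0 X_mult_compose_nth_eq_0 del: fps_X_mult_nth)
  also have "fps_X ^ 4 * ((64 * theta3 ^ 7 * ty * theta2 ^ 4) oo fps_X ^ 4) = (64 * seven_form) oo fps_X ^ 4"
    by (simp add: seven_form_def tx_def compose_distribs mult_ac)
  finally show ?thesis by (simp add: fps_compose_X_power_nth numeral_fps_const)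
qed

text \<open>In residue 3 only j = 7 remains. Its inner series is even in q, since q -> -q swaps
  \<open>ty\<close> and \<open>tz\<close>, and the exponent 8 b + 3 reads it at the odd index 2 b -
  1; for b = 0 the exponent lies below q^7.\<close>

lemma seven_form_nth_3_mod_8: "seven_form $ (8 * b + 3) = 0"
proof -
  let ?g = "64 * theta3 ^ 4 * ty * theta2 ^ 7"
  have "(8 * b + 3) mod 4 = 3" by presburger
  then have "seven_form $ (8 * b + 3) = (fps_X ^ 7 * (?g oo fps_X ^ 4)) $ (8 * b + 3)"
    unfolding seven_form_expand by (simp add: X_power_mult_compose_nth_eq_0 X_mult_compose_nth_eq_0 del: fps_X_mult_nth)
  also have "\<dots> = 0"
  proof (cases b)
    case (Suc c)
    have e: "?g oo - fps_X = ?g"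
      by (simp add: tz_def[symmetric] compose_distribs t_neg theta2_neg)
    have "8 * b + 3 - 7 = 4 * (2 * c + 1)" using Suc by simp
    then have "(8 * b + 3 - 7) div 4 = 2 * c + 1" by simp
    then show ?thesis using nth_odd_eq_0[OF e, of "2 * c + 1"]
      by (simp only: X_power_mult_compose_nth) simp
  qed (simp add: X_power_mult_compose_nth)
  finally show ?thesis .
qed

lemma seven_form_nth: "seven_form $ (4 ^ a * (8 * b + 3)) = 0"
proof (induction a)
  case (Suc a)
  then show ?case using seven_form_nth_4[of "4 ^ a * (8 * b + 3)"] by (simp only: power_Suc mult.assoc)
qed (simp add: seven_form_nth_3_mod_8)

section \<open>Dimension 40: computation with truncated series\<close>

definition trunc_mult :: "int list \<Rightarrow> int list \<Rightarrow> int list" where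
  "trunc_mult xs ys = map (\<lambda>n. sum_list (map (\<lambda>i. xs ! i * ys ! (n - i)) [0..<Suc n])) [0..<8]"

text \<open>Eight coefficients suffice: the exponent 24 - 40/4 = 14 is halved by the doubling
  formulas, so the coefficient of q^7 decides.\<close>

definition has_prefix :: "real fps \<Rightarrow> int list \<Rightarrow> bool" where
  "has_prefix f xs \<longleftrightarrow> (\<forall>n<8. f $ n = of_int (xs ! n))"

lemma has_prefix_mult:
  assumes "has_prefix f xs" "has_prefix g ys" "trunc_mult xs ys = zs"
  shows "has_prefix (f * g) zs"
  unfolding has_prefix_def
proof (intro allI impI)
  fix n :: nat assume n: "n < 8"
  have "(f * g) $ n = (\<Sum>i\<in>{0..<Suc n}. f $ i * g $ (n - i))"
    by (simp add: fps_mult_nth atLeastLessThanSuc_atLeastAtMost)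
  also have "\<dots> = (\<Sum>i\<in>{0..<Suc n}. of_int (xs ! i * ys ! (n - i)))"
    using assms(1,2) n by (intro sum.cong) (auto simp: has_prefix_def)
  also have "\<dots> = of_int (trunc_mult xs ys ! n)"
    using n by (simp add: trunc_mult_def interv_sum_list_conv_sum_set_nat del: upt_Suc)
  finally show "(f * g) $ n = of_int (zs ! n)" using assms(3) by simp
qed

lemma has_prefix_add:
  assumes "has_prefix f xs" "has_prefix g ys" "length xs = 8" "length ys = 8" "map2 (+) xs ys = zs"
  shows "has_prefix (f + g) zs"
  using assms by (auto simp: has_prefix_def)

lemma theta3_prefix: "has_prefix theta3 [1, 2, 0, 0, 2, 0, 0, 0]"
proof -
  let ?K = "{-2, -1, 0, 1, 2 :: int}"
  have "theta3 $ n = (\<Sum>k\<in>?K. if k * k = int n then 1 else 0)" if "n < 8" for n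
  proof -
    have "k \<in> ?K" if "k * k = int n" for k
    proof -
      have "\<bar>k\<bar> < 3"
      proof (rule ccontr)
        assume "\<not> \<bar>k\<bar> < 3"
        then have "3 * 3 \<le> \<bar>k\<bar> * \<bar>k\<bar>" by (intro mult_mono) auto
        with that \<open>n < 8\<close> show False by simp
      qed
      then show ?thesis by auto
    qed
    then have "{k. k * k = int n} = {k \<in> ?K. k * k = int n}" by blast
    then show ?thesis by (simp only: theta3_nth) (simp add: sum.If_cases Int_def)
  qed
  then show ?thesis
    unfolding has_prefix_def by (simp add: numeral_eq_Suc less_Suc_eq all_conj_distrib)
qed

lemma theta2_prefix: "has_prefix theta2 [2, 0, 2, 0, 0, 0, 2, 0]"
proof -
  let ?K = "{-3, -2, -1, 0, 1, 2 :: int}"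
  have "theta2 $ n = (\<Sum>k\<in>?K. if k * (k + 1) = int n then 1 else 0)" if "n < 8" for n
  proof -
    have "k \<in> ?K" if "k * (k + 1) = int n" for k
    proof -
      have "k < 3"
      proof (rule ccontr)
        assume "\<not> k < 3"
        then have "3 * 4 \<le> k * (k + 1)" by (intro mult_mono) auto
        with that \<open>n < 8\<close> show False by simp
      qed
      moreover have "k > -4"
      proof (rule ccontr)
        assume "\<not> k > -4"
        then have "4 * 3 \<le> (- k) * (- (k + 1))" by (intro mult_mono) auto
        with that \<open>n < 8\<close> show False by (simp add: algebra_simps)
      qed
      ultimately show ?thesis by auto
    qed
    then have "{k. k * (k + 1) = int n} = {k \<in> ?K. k * (k + 1) = int n}" by blast
    then show ?thesis by (simp only: theta2_nth) (simp add: sum.If_cases Int_def)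
  qed
  then show ?thesis
    unfolding has_prefix_def by (simp add: numeral_eq_Suc less_Suc_eq all_conj_distrib)
qed

lemma theta4_prefix: "has_prefix theta4 [1, -2, 0, 0, 2, 0, 0, 0]"
  using theta3_prefix unfolding has_prefix_def theta4_def fps_compose_uminus'
  by (simp add: numeral_eq_Suc less_Suc_eq all_conj_distrib)

lemma X_prefix: "has_prefix fps_X [0, 1, 0, 0, 0, 0, 0, 0]"
  unfolding has_prefix_def by (simp add: numeral_eq_Suc less_Suc_eq all_conj_distrib)

lemma has_prefix_square:
  assumes "has_prefix (f ^ n) xs" "trunc_mult xs xs = ys"
  shows "has_prefix (f ^ (2 * n)) ys"
  using has_prefix_mult[OF assms(1,1)] assms(2) by (simp add: mult_2 power_add)

text \<open>The entry that matters is the final 0. The power 20 is reached through 1, 2, 4, 5, 10 by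
  squarings and one extra product.\<close>

lemma shadow40_prefix:
  "has_prefix ((theta2 * theta3) ^ 20 * (ty ^ 2 * (tx + tz))) [1048576, 50331648, 893386752, 8589934592, 50866421760, 189850976256, 392997896192, 0]"
proof -
  have p1: "has_prefix (theta2 * theta3) [2, 4, 2, 4, 4, 0, 6, 4]"
    by (rule has_prefix_mult[OF theta2_prefix theta3_prefix]) code_simp
  have p1': "has_prefix ((theta2 * theta3) ^ 1) [2, 4, 2, 4, 4, 0, 6, 4]" using p1 by simp
  have p2: "has_prefix ((theta2 * theta3) ^ (2 * 1)) [4, 16, 24, 32, 52, 48, 56, 96]"
    by (rule has_prefix_square[OF p1']) code_simp
  have p4: "has_prefix ((theta2 * theta3) ^ (2 * 2)) [16, 128, 448, 1024, 2016, 3584, 5504, 8192]"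
    by (rule has_prefix_square[OF p2[simplified]]) code_simp
  have p5: "has_prefix ((theta2 * theta3) ^ 4 * (theta2 * theta3)) [32, 320, 1440, 4160, 9600, 19584, 35360, 58560]"
    by (rule has_prefix_mult[OF p4[simplified] p1]) code_simp
  have p5': "has_prefix ((theta2 * theta3) ^ 5) [32, 320, 1440, 4160, 9600, 19584, 35360, 58560]" using p5 by (simp add: eval_nat_numeral mult_ac)
  have p10: "has_prefix ((theta2 * theta3) ^ (2 * 5)) [1024, 20480, 194560, 1187840, 5350400, 19378176, 59750400, 162652160]"
    by (rule has_prefix_square[OF p5']) code_simp
  have p20: "has_prefix ((theta2 * theta3) ^ (2 * 10)) [1048576, 41943040, 817889280, 10401873920, 97465139200, 721051189248, 4409010421760, 23031762124800]"
    by (rule has_prefix_square[OF p10[simplified]]) code_simp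
  have a1: "has_prefix (theta4 ^ 1) [1, -2, 0, 0, 2, 0, 0, 0]" using theta4_prefix by simp
  have a2: "has_prefix (theta4 ^ (2 * 1)) [1, -4, 4, 0, 4, -8, 0, 0]"
    by (rule has_prefix_square[OF a1]) code_simp
  have a4: "has_prefix (theta4 ^ (2 * 2)) [1, -8, 24, -32, 24, -48, 96, -64]"
    by (rule has_prefix_square[OF a2[simplified]]) code_simp
  have a8: "has_prefix (theta4 ^ (2 * 4)) [1, -16, 112, -448, 1136, -2016, 3136, -5504]"
    by (rule has_prefix_square[OF a4[simplified]]) code_simp
  have b1: "has_prefix (theta3 ^ 1) [1, 2, 0, 0, 2, 0, 0, 0]" using theta3_prefix by simp
  have b2: "has_prefix (theta3 ^ (2 * 1)) [1, 4, 4, 0, 4, 8, 0, 0]"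
    by (rule has_prefix_square[OF b1]) code_simp
  have b4: "has_prefix (theta3 ^ (2 * 2)) [1, 8, 24, 32, 24, 48, 96, 64]"
    by (rule has_prefix_square[OF b2[simplified]]) code_simp
  have c1: "has_prefix (theta2 ^ 1) [2, 0, 2, 0, 0, 0, 2, 0]" using theta2_prefix by simp
  have c2: "has_prefix (theta2 ^ (2 * 1)) [4, 0, 8, 0, 4, 0, 8, 0]"
    by (rule has_prefix_square[OF c1]) code_simp
  have c4: "has_prefix (theta2 ^ (2 * 2)) [16, 0, 64, 0, 96, 0, 128, 0]"
    by (rule has_prefix_square[OF c2[simplified]]) code_simp
  have x: "has_prefix tx [0, 16, 0, 64, 0, 96, 0, 128]"
    unfolding tx_def by (rule has_prefix_mult[OF X_prefix c4[simplified]]) code_simp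
  have xz: "has_prefix (tx + tz) [1, 24, 24, 96, 24, 144, 96, 192]"
    unfolding tz_def by (rule has_prefix_add[OF x b4[simplified]]) simp_all
  have y2: "has_prefix (ty ^ 2) [1, -16, 112, -448, 1136, -2016, 3136, -5504]" using a8 by (simp add: ty_def flip: power_mult)
  have q: "has_prefix (ty ^ 2 * (tx + tz)) [1, 8, -248, 1952, -8440, 25008, -60512, 134464]"
    by (rule has_prefix_mult[OF y2 xz]) code_simp
  show ?thesis by (rule has_prefix_mult[OF p20[simplified] q]) code_simp
qed

lemma shadow40_nth: "(theta2 ^ 40 * (ty * tz * (ty + tz))) $ 14 = 0"
proof -
  let ?W = "(theta2 * theta3) ^ 20 * (ty ^ 2 * (tx + tz))"
  have "theta2 ^ 40 * (ty * tz * (ty + tz)) = (theta2 ^ 2) ^ 20 * (ty * tz * (ty + tz))"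
    by (simp flip: power_mult)
  also have "\<dots> = 2 ^ 21 * ?W oo fps_X ^ 2"
    unfolding theta2_square ty_tz_mult ty_tz_add by (simp add: compose_distribs power_mult_distrib)
  finally have *: "theta2 ^ 40 * (ty * tz * (ty + tz)) = 2 ^ 21 * ?W oo fps_X ^ 2" .
  have c: "(2 ^ 21 :: real fps) = fps_const (2 ^ 21)" by (simp add: numeral_fps_const)
  have W: "?W $ 7 = 0" using shadow40_prefix by (simp add: has_prefix_def)
  show ?thesis
    unfolding * fps_compose_X_power_nth[OF zero_less_numeral] c fps_mult_left_const_nth by (simp add: W)
qed

section \<open>Moments and the design conditions\<close>

lemma finite_multi_idx: "finite (multi_idx n d)"
proof -
  have "multi_idx n d \<subseteq> {\<alpha>. \<forall>i. (i \<in> {..<n} \<longrightarrow> \<alpha> i \<in> {..d}) \<and> (i \<notin> {..<n} \<longrightarrow> \<alpha> i = 0)}"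
    by (auto simp: multi_idx_def) (metis finite_lessThan lessThan_iff member_le_sum zero_le)
  then show ?thesis by (rule finite_subset) (intro finite_set_of_finite_funs; simp)
qed

lemma sum_fun_upd:
  fixes f :: "nat \<Rightarrow> nat"
  assumes "i < n"
  shows "(\<Sum>l<n. (f(i := v)) l) + f i = (\<Sum>l<n. f l) + v"
  using assms sum.remove[of "{..<n}" i f] sum.remove[of "{..<n}" i "f(i := v)"] by simp

lemma prod_fun_upd:
  fixes g :: "nat \<Rightarrow> 'b::comm_semiring_1" and i n :: nat
  assumes "i < n" "\<alpha> i = 0" "g 0 = 1"
  shows "(\<Prod>l<n. g ((\<alpha>(i := v)) l)) = g v * (\<Prod>l<n. g (\<alpha> l))"
proof -
  have "(\<Prod>l<n. g ((\<alpha>(i := v)) l)) = g v * (\<Prod>l\<in>{..<n} - {i}. g (\<alpha> l))"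
    using prod.remove[of "{..<n}" i "\<lambda>l. g ((\<alpha>(i := v)) l)"] assms(1) by simp
  also have "(\<Prod>l\<in>{..<n} - {i}. g (\<alpha> l)) = (\<Prod>l<n. g (\<alpha> l))"
    using prod.remove[of "{..<n}" i "\<lambda>l. g (\<alpha> l)"] assms by simp
  finally show ?thesis .
qed

text \<open>The premise says that the moment functional lies in the image of the transposed Laplacian.\<close>

lemma design_condI:
  assumes moments: "\<And>\<alpha>. \<alpha> \<in> multi_idx n k \<Longrightarrow> (\<Sum>x\<in>X. \<Prod>i<n. x i ^ \<alpha> i) =
    (\<Sum>i<n. real (\<alpha> i * (\<alpha> i - 1)) * b (\<alpha>(i := \<alpha> i - 2)))"
  shows "design_cond n X k"
  unfolding design_cond_def
proof (intro allI impI)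
  fix c assume h: "harmonic_coeffs n k c"
  then have k: "2 \<le> k" by (simp add: harmonic_coeffs_def)
  let ?t = "\<lambda>i \<alpha>. c \<alpha> * (real (\<alpha> i * (\<alpha> i - 1)) * b (\<alpha>(i := \<alpha> i - 2)))"
  let ?s = "\<lambda>i \<beta>. b \<beta> * (real ((\<beta> i + 2) * (\<beta> i + 1)) * c (\<beta>(i := \<beta> i + 2)))"
  have "(\<Sum>x\<in>X. hpoly_eval n k c x) = (\<Sum>\<alpha>\<in>multi_idx n k. c \<alpha> * (\<Sum>x\<in>X. \<Prod>i<n. x i ^ \<alpha> i))"
    unfolding hpoly_eval_def by (subst sum.swap) (simp add: sum_distrib_left)
  also have "\<dots> = (\<Sum>i<n. \<Sum>\<alpha>\<in>multi_idx n k. ?t i \<alpha>)"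
    by (subst sum.swap) (simp add: moments sum_distrib_left)
  also have "\<dots> = (\<Sum>i<n. \<Sum>\<beta>\<in>multi_idx n (k - 2). ?s i \<beta>)"
  proof (rule sum.cong[OF refl])
    fix i assume i: "i \<in> {..<n}"
    \<comment> \<open>For \<alpha> i < 2 the truncated \<alpha> i - 2 is not inverse to adding 2,
      but there the factor \<alpha> i (\<alpha> i - 1) is 0.\<close>
    have "(\<Sum>\<alpha>\<in>multi_idx n k. ?t i \<alpha>) = (\<Sum>\<alpha> | \<alpha> \<in> multi_idx n k \<and> 2 \<le> \<alpha> i. ?t i \<alpha>)"
    proof (rule sum.mono_neutral_right[OF finite_multi_idx])
      show "\<forall>\<alpha>\<in>multi_idx n k - {\<alpha>. \<alpha> \<in> multi_idx n k \<and> 2 \<le> \<alpha> i}. ?t i \<alpha> = 0"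
      proof
        fix \<alpha> assume "\<alpha> \<in> multi_idx n k - {\<alpha>. \<alpha> \<in> multi_idx n k \<and> 2 \<le> \<alpha> i}"
        then have "\<alpha> i = 0 \<or> \<alpha> i = 1" by auto
        then show "?t i \<alpha> = 0" by auto
      qed
    qed auto
    also have "\<dots> = (\<Sum>\<beta>\<in>multi_idx n (k - 2). ?s i \<beta>)"
    proof (rule sum.reindex_bij_witness[where i = "\<lambda>\<beta>. \<beta>(i := \<beta> i + 2)" and j = "\<lambda>\<alpha>. \<alpha>(i := \<alpha> i - 2)"])
      fix \<alpha> assume "\<alpha> \<in> {\<alpha>. \<alpha> \<in> multi_idx n k \<and> 2 \<le> \<alpha> i}"
      then show "\<alpha>(i := \<alpha> i - 2) \<in> multi_idx n (k - 2)"
        using i sum_fun_upd[of i n \<alpha> "\<alpha> i - 2"] by (auto simp: multi_idx_def)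
    next
      fix \<beta> assume "\<beta> \<in> multi_idx n (k - 2)"
      then show "\<beta>(i := \<beta> i + 2) \<in> {\<alpha>. \<alpha> \<in> multi_idx n k \<and> 2 \<le> \<alpha> i}"
        using i k sum_fun_upd[of i n \<beta> "\<beta> i + 2"] by (auto simp: multi_idx_def)
    next
      fix \<alpha> assume "\<alpha> \<in> {\<alpha>. \<alpha> \<in> multi_idx n k \<and> 2 \<le> \<alpha> i}"
      then have 2: "2 \<le> \<alpha> i" by simp
      then have "\<alpha> i - 2 + 2 = \<alpha> i" "\<alpha> i - 2 + 1 = \<alpha> i - 1" by auto
      then show "?s i (\<alpha>(i := \<alpha> i - 2)) = ?t i \<alpha>" by (simp only: fun_upd_same fun_upd_upd fun_upd_triv ac_simps)
    qed (auto simp: fun_eq_iff)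
    finally show "(\<Sum>\<alpha>\<in>multi_idx n k. ?t i \<alpha>) = (\<Sum>\<beta>\<in>multi_idx n (k - 2). ?s i \<beta>)" .
  qed
  also have "\<dots> = (\<Sum>\<beta>\<in>multi_idx n (k - 2). b \<beta> * (\<Sum>i<n. real ((\<beta> i + 2) * (\<beta> i + 1)) * c (\<beta>(i := \<beta> i + 2))))"
    by (subst sum.swap) (simp only: sum_distrib_left)
  also have "\<dots> = 0" using h by (intro sum.neutral) (simp add: harmonic_coeffs_def)
  finally show "(\<Sum>x\<in>X. hpoly_eval n k c x) = 0" .
qed

text \<open>Iterated, this writes an even multi-index of degree 2, 4 or 6 as a sum of doubled unit
  vectors, which enumerates the types.\<close>

lemma even_multi_idx_peel:
  assumes "\<alpha> \<in> multi_idx n k" "k = d + 2" "\<And>i. i < n \<Longrightarrow> even (\<alpha> i)"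
  obtains i \<beta> where "i < n" "\<beta> \<in> multi_idx n d" "\<And>i. i < n \<Longrightarrow> even (\<beta> i)" "\<alpha> = \<beta>(i := \<beta> i + 2)"
proof -
  have "\<exists>i<n. \<alpha> i \<noteq> 0"
  proof (rule ccontr)
    assume "\<not> ?thesis"
    then have "(\<Sum>i<n. \<alpha> i) = 0" by auto
    then show False using assms(1,2) by (simp add: multi_idx_def)
  qed
  then obtain i where i: "i < n" "\<alpha> i \<noteq> 0" by blast
  then have 2: "\<alpha> i \<ge> 2" using assms(3)[of i] by (cases "\<alpha> i = 1") auto
  show thesis
  proof (rule that[of i "\<alpha>(i := \<alpha> i - 2)"])
    show "\<alpha>(i := \<alpha> i - 2) \<in> multi_idx n d"
      using i 2 assms(1,2) sum_fun_upd[of i n \<alpha> "\<alpha> i - 2"] by (auto simp: multi_idx_def)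
    show "\<alpha> = (\<alpha>(i := \<alpha> i - 2))(i := (\<alpha>(i := \<alpha> i - 2)) i + 2)"
      using 2 by (auto simp: fun_eq_iff)
  qed (use i assms(3) in auto)
qed

lemma multi_idx_0: "\<alpha> \<in> multi_idx n 0 \<Longrightarrow> \<alpha> = (\<lambda>_. 0)"
  by (auto simp: multi_idx_def fun_eq_iff) (meson lessThan_iff not_le)

text \<open>Resetting \<open>b\<close> to 0 at multi-indices with an odd entry makes the equation
  for such \<alpha> read 0 = 0. Lowering an entry by 2 preserves parity, and where the subtraction
  truncates the factor is 0, so the even equations are untouched.\<close>

lemma design_cond_evenI:
  assumes odd: "\<And>\<alpha> i. i < n \<Longrightarrow> odd (\<alpha> i) \<Longrightarrow> (\<Sum>x\<in>X. \<Prod>i<n. x i ^ \<alpha> i) = 0"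
  assumes even: "\<And>\<alpha>. \<alpha> \<in> multi_idx n k \<Longrightarrow> (\<And>i. i < n \<Longrightarrow> even (\<alpha> i)) \<Longrightarrow> (\<Sum>x\<in>X. \<Prod>i<n. x i ^ \<alpha> i) =
    (\<Sum>i<n. real (\<alpha> i * (\<alpha> i - 1)) * b (\<alpha>(i := \<alpha> i - 2)))"
  shows "design_cond n X k"
proof (rule design_condI[where b = "\<lambda>\<beta>. if \<forall>i<n. even (\<beta> i) then b \<beta> else 0"])
  fix \<alpha> assume \<alpha>: "\<alpha> \<in> multi_idx n k"
  have par: "real (\<alpha> i * (\<alpha> i - 1)) * (if \<forall>l<n. even ((\<alpha>(i := \<alpha> i - 2)) l) then v else 0) =
      real (\<alpha> i * (\<alpha> i - 1)) * (if \<forall>l<n. even (\<alpha> l) then v else 0)" if "i < n" for i v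
  proof (cases "2 \<le> \<alpha> i")
    case True
    then have "(\<forall>l<n. even ((\<alpha>(i := \<alpha> i - 2)) l)) \<longleftrightarrow> (\<forall>l<n. even (\<alpha> l))" by auto
    then show ?thesis by (simp only:)
  next
    case False
    then have "\<alpha> i = 0 \<or> \<alpha> i = 1" by auto
    then have "real (\<alpha> i * (\<alpha> i - 1)) = 0" by auto
    then show ?thesis by (simp only: mult_zero_left)
  qed
  have "(\<Sum>x\<in>X. \<Prod>i<n. x i ^ \<alpha> i) = (\<Sum>i<n. real (\<alpha> i * (\<alpha> i - 1)) *
      (if \<forall>l<n. even (\<alpha> l) then b (\<alpha>(i := \<alpha> i - 2)) else 0))"
  proof (cases "\<forall>l<n. even (\<alpha> l)")
    case True
    then show ?thesis using even[OF \<alpha>] by (simp only: if_P[OF True])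
  next
    case False
    then obtain i where "i < n" "odd (\<alpha> i)" by auto
    from odd[of i \<alpha>, OF this] show ?thesis by (simp only: if_not_P[OF False] mult_zero_right sum.neutral_const)
  qed
  also have "\<dots> = (\<Sum>i<n. real (\<alpha> i * (\<alpha> i - 1)) *
      (if \<forall>l<n. even ((\<alpha>(i := \<alpha> i - 2)) l) then b (\<alpha>(i := \<alpha> i - 2)) else 0))"
    by (rule sum.cong[OF refl], rule par[symmetric]) (simp only: lessThan_iff)
  finally show "(\<Sum>x\<in>X. \<Prod>i<n. x i ^ \<alpha> i) = (\<Sum>i<n. real (\<alpha> i * (\<alpha> i - 1)) *
      (if \<forall>l<n. even ((\<alpha>(i := \<alpha> i - 2)) l) then b (\<alpha>(i := \<alpha> i - 2)) else 0))" .
qed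

lemma sum_restrict:
  fixes f :: "nat \<Rightarrow> real"
  assumes "A \<subseteq> {..<n}" "\<And>i. i < n \<Longrightarrow> i \<notin> A \<Longrightarrow> f i = 0"
  shows "(\<Sum>i<n. f i) = (\<Sum>i\<in>A. f i)"
  using assms by (intro sum.mono_neutral_right) auto

section \<open>Design conditions for moments that factor over the coordinates\<close>

context
  fixes n M :: nat and X :: "(nat \<Rightarrow> real) set" and G g :: "nat \<Rightarrow> real fps"
  assumes moment: "\<And>\<alpha>. (\<Sum>x\<in>X. \<Prod>i<n. x i ^ \<alpha> i) = (\<Prod>i<n. G (\<alpha> i)) $ M"
  assumes G_odd: "\<And>j. odd j \<Longrightarrow> G j = 0"
  assumes G_eq: "\<And>j. G j = g j * G 0" and g_0: "g 0 = 1"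
begin

lemma moment_odd: "i < n \<Longrightarrow> odd (\<alpha> i) \<Longrightarrow> (\<Sum>x\<in>X. \<Prod>i<n. x i ^ \<alpha> i) = 0"
  unfolding moment using G_odd by (subst prod_zero) auto

lemma moment_normalized: "(\<Sum>x\<in>X. \<Prod>i<n. x i ^ \<alpha> i) = (G 0 ^ n * (\<Prod>i<n. g (\<alpha> i))) $ M"
proof -
  have "(\<Prod>i<n. G (\<alpha> i)) = (\<Prod>i<n. g (\<alpha> i) * G 0)" by (rule prod.cong[OF refl G_eq])
  then show ?thesis by (simp add: moment prod.distrib mult.commute)
qed

text \<open>There is a single type of even multi-index, 2 e_i, with factor 2 * 1, so a constant
  \<open>b\<close> always works.\<close>

lemma design_cond_2: "design_cond n X 2"
proof (rule design_cond_evenI[where b = "\<lambda>_. (G 0 ^ n * g 2) $ M / 2"])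
  fix \<alpha> assume a: "\<alpha> \<in> multi_idx n 2" "\<And>i. i < n \<Longrightarrow> even (\<alpha> i)"
  obtain i \<beta> where i: "i < n" "\<beta> \<in> multi_idx n 0" "\<alpha> = \<beta>(i := \<beta> i + 2)"
    by (rule even_multi_idx_peel[OF a(1) _ a(2), of 0]) auto
  then have \<alpha>: "\<alpha> = (\<lambda>_. 0)(i := 2)" using multi_idx_0[OF i(2)] by (simp add: numeral_2_eq_2)
  have "(\<Sum>l<n. real (\<alpha> l * (\<alpha> l - 1)) * ((G 0 ^ n * g 2) $ M / 2)) =
      (\<Sum>l\<in>{i}. real (\<alpha> l * (\<alpha> l - 1)) * ((G 0 ^ n * g 2) $ M / 2))"
    using i(1) by (intro sum_restrict) (auto simp: \<alpha>)
  also have "\<dots> = (G 0 ^ n * g 2) $ M" by (simp add: \<alpha>)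
  also have "\<dots> = (G 0 ^ n * (\<Prod>i<n. g (\<alpha> i))) $ M"
    using i(1) by (simp add: \<alpha> prod_fun_upd g_0 del: fun_upd_apply)
  finally show "(\<Sum>x\<in>X. \<Prod>i<n. x i ^ \<alpha> i) = (\<Sum>i<n. real (\<alpha> i * (\<alpha> i - 1)) * ((G 0 ^ n * g 2) $ M / 2))"
    unfolding moment_normalized by (rule sym)
qed (rule moment_odd)

text \<open>A constant b must satisfy 4 b = g_2^2 for type (2,2) and 12 b = g_4 for type (4), each
  multiplied by \<open>G 0 ^ n\<close> and read at q^M. The hypothesis is their
  compatibility.\<close>

lemma design_cond_4:
  assumes "(G 0 ^ n * (g 4 - 3 * g 2 ^ 2)) $ M = 0"
  shows "design_cond n X 4"
proof (rule design_cond_evenI[where b = "\<lambda>_. (G 0 ^ n * g 2 ^ 2) $ M / 4"])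
  let ?b = "(G 0 ^ n * g 2 ^ 2) $ M / 4"
  have A: "(G 0 ^ n * g 4) $ M = 12 * ?b"
    using assms by (simp add: algebra_simps numeral_fps_const)
  fix \<alpha> assume a: "\<alpha> \<in> multi_idx n 4" "\<And>i. i < n \<Longrightarrow> even (\<alpha> i)"
  obtain i \<beta> where i: "i < n" "\<beta> \<in> multi_idx n 2" "\<And>i. i < n \<Longrightarrow> even (\<beta> i)"
      "\<alpha> = \<beta>(i := \<beta> i + 2)"
    by (rule even_multi_idx_peel[OF a(1) _ a(2), of 2]) auto
  obtain j \<gamma> where j: "j < n" "\<gamma> \<in> multi_idx n 0" "\<beta> = \<gamma>(j := \<gamma> j + 2)"
    by (rule even_multi_idx_peel[OF i(2) _ i(3), of 0]) auto
  have \<beta>: "\<beta> = (\<lambda>_. 0)(j := 2)" using j multi_idx_0[OF j(2)] by (simp add: numeral_2_eq_2)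
  show "(\<Sum>x\<in>X. \<Prod>i<n. x i ^ \<alpha> i) = (\<Sum>l<n. real (\<alpha> l * (\<alpha> l - 1)) * ?b)"
  proof (cases "i = j")
    case True
    then have \<alpha>: "\<alpha> = (\<lambda>_. 0)(i := 4)" using i \<beta> by auto
    have "(\<Sum>l<n. real (\<alpha> l * (\<alpha> l - 1)) * ?b) = (\<Sum>l\<in>{i}. real (\<alpha> l * (\<alpha> l - 1)) * ?b)"
      using i(1) by (intro sum_restrict) (auto simp: \<alpha>)
    also have "\<dots> = (G 0 ^ n * g 4) $ M" unfolding A by (simp add: \<alpha>)
    also have "g 4 = (\<Prod>i<n. g (\<alpha> i))"
      using i(1) by (simp add: \<alpha> prod_fun_upd g_0 del: fun_upd_apply)
    finally show ?thesis unfolding moment_normalized by (rule sym)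
  next
    case False
    then have \<alpha>: "\<alpha> = (\<lambda>_. 0)(j := 2, i := 2)" using i \<beta> by auto
    have "(\<Sum>l<n. real (\<alpha> l * (\<alpha> l - 1)) * ?b) = (\<Sum>l\<in>{i, j}. real (\<alpha> l * (\<alpha> l - 1)) * ?b)"
      using i(1) j(1) by (intro sum_restrict) (auto simp: \<alpha>)
    also have "\<dots> = (G 0 ^ n * g 2 ^ 2) $ M" using False by (simp add: \<alpha>)
    also have "\<dots> = (G 0 ^ n * (\<Prod>i<n. g (\<alpha> i))) $ M"
    proof -
      have "((\<lambda>_. 0)(j := 2)) i = (0::nat)" using False by simp
      then show ?thesis
        using i(1) j(1) by (simp add: \<alpha> prod_fun_upd g_0 power2_eq_square del: fun_upd_apply)
    qed
    finally show ?thesis unfolding moment_normalized by (rule sym)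
  qed
qed (rule moment_odd)

lemma design_cond_6:
  assumes "n = 2 \<or> (G 0 ^ n * (g 6 - 15 * g 4 * g 2 + 30 * g 2 ^ 3)) $ M = 0"
  shows "design_cond n X 6"
proof -
  \<comment> \<open>p and r are the values of b at 4 e_l and at 2 e_u + 2 e_v. The types (6), (4,2),
    (2,2,2) demand 30 p, 12 r + 2 p and 6 r. The first two fix p and r; the third is the hypothesis,
    or does not occur when n = 2.\<close>
  define p where "p = (G 0 ^ n * g 6) $ M / 30"
  define r where "r = ((G 0 ^ n * (g 4 * g 2)) $ M - 2 * p) / 12"
  define b where "b = (\<lambda>\<beta>::nat \<Rightarrow> nat. if \<exists>l<n. \<beta> l = 4 then p else r)"
  have r: "(G 0 ^ n * g 2 ^ 3) $ M = 6 * r" if "n \<noteq> 2"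
  proof -
    have "G 0 ^ n * (g 6 - 15 * g 4 * g 2 + 30 * g 2 ^ 3) =
        G 0 ^ n * g 6 - fps_const 15 * (G 0 ^ n * (g 4 * g 2)) + fps_const 30 * (G 0 ^ n * g 2 ^ 3)"
      by (simp add: numeral_fps_const algebra_simps)
    with assms that show ?thesis by (simp add: r_def p_def)
  qed
  show ?thesis
  proof (rule design_cond_evenI[where b = b])
    fix \<alpha> assume a: "\<alpha> \<in> multi_idx n 6" "\<And>i. i < n \<Longrightarrow> even (\<alpha> i)"
    obtain i \<beta> where i: "i < n" "\<beta> \<in> multi_idx n 4" "\<And>i. i < n \<Longrightarrow> even (\<beta> i)"
        "\<alpha> = \<beta>(i := \<beta> i + 2)"
      by (rule even_multi_idx_peel[OF a(1) _ a(2), of 4]) auto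
    obtain j \<gamma> where j: "j < n" "\<gamma> \<in> multi_idx n 2" "\<And>i. i < n \<Longrightarrow> even (\<gamma> i)"
        "\<beta> = \<gamma>(j := \<gamma> j + 2)"
      by (rule even_multi_idx_peel[OF i(2) _ i(3), of 2]) auto
    obtain k \<zeta> where k: "k < n" "\<zeta> \<in> multi_idx n 0" "\<gamma> = \<zeta>(k := \<zeta> k + 2)"
      by (rule even_multi_idx_peel[OF j(2) _ j(3), of 0]) auto
    have \<gamma>: "\<gamma> = (\<lambda>_. 0)(k := 2)" using k multi_idx_0[OF k(2)] by (simp add: numeral_2_eq_2)
    have "(\<exists>u<n. \<alpha> = (\<lambda>_. 0)(u := 6)) \<or>
        (\<exists>u v. u < n \<and> v < n \<and> u \<noteq> v \<and> \<alpha> = (\<lambda>_. 0)(u := 4, v := 2)) \<or>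
        (i \<noteq> j \<and> i \<noteq> k \<and> j \<noteq> k \<and> \<alpha> = (\<lambda>_. 0)(k := 2, j := 2, i := 2))"
    proof (cases "i = j"; cases "j = k"; cases "i = k")
      assume "i = j" "j \<noteq> k" "i \<noteq> k"
      then have "\<alpha> = (\<lambda>_. 0)(i := 4, k := 2)" using i j \<gamma> by auto
      then show ?thesis using i k \<open>i \<noteq> k\<close> by blast
    next
      assume "i \<noteq> j" "j = k" "i \<noteq> k"
      then have "\<alpha> = (\<lambda>_. 0)(j := 4, i := 2)" using i j \<gamma> by auto
      then show ?thesis using i j \<open>i \<noteq> j\<close> by blast
    next
      assume "i \<noteq> j" "j \<noteq> k" "i = k"
      then have "\<alpha> = (\<lambda>_. 0)(i := 4, j := 2)" using i j \<gamma> by auto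
      then show ?thesis using i j \<open>i \<noteq> j\<close> by blast
    next
      assume "i = j" "j = k"
      then have "\<alpha> = (\<lambda>_. 0)(i := 6)" using i j \<gamma> by auto
      then show ?thesis using i by blast
    qed (use i j \<gamma> in auto)
    then consider
      (6) u where "u < n" "\<alpha> = (\<lambda>_. 0)(u := 6)" |
      (42) u v where "u < n" "v < n" "u \<noteq> v" "\<alpha> = (\<lambda>_. 0)(u := 4, v := 2)" |
      (222) "i \<noteq> j" "i \<noteq> k" "j \<noteq> k" "\<alpha> = (\<lambda>_. 0)(k := 2, j := 2, i := 2)"
      by blast
    then show "(\<Sum>x\<in>X. \<Prod>i<n. x i ^ \<alpha> i) =
        (\<Sum>l<n. real (\<alpha> l * (\<alpha> l - 1)) * b (\<alpha>(l := \<alpha> l - 2)))"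
    proof cases
      case 6
      have "(\<Sum>l<n. real (\<alpha> l * (\<alpha> l - 1)) * b (\<alpha>(l := \<alpha> l - 2))) =
          (\<Sum>l\<in>{u}. real (\<alpha> l * (\<alpha> l - 1)) * b (\<alpha>(l := \<alpha> l - 2)))"
        using 6 by (intro sum_restrict) auto
      also have "\<dots> = 30 * p" using 6 by (auto simp: b_def)
      also have "\<dots> = (G 0 ^ n * g 6) $ M" by (simp add: p_def)
      also have "g 6 = (\<Prod>i<n. g (\<alpha> i))"
        using 6 by (simp add: prod_fun_upd g_0 del: fun_upd_apply)
      finally show ?thesis unfolding moment_normalized by (rule sym)
    next
      case 42
      have "(\<Sum>l<n. real (\<alpha> l * (\<alpha> l - 1)) * b (\<alpha>(l := \<alpha> l - 2))) =
          (\<Sum>l\<in>{u, v}. real (\<alpha> l * (\<alpha> l - 1)) * b (\<alpha>(l := \<alpha> l - 2)))"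
        using 42 by (intro sum_restrict) auto
      also have "\<dots> = 12 * r + 2 * p" using 42 by (auto simp: b_def)
      also have "\<dots> = (G 0 ^ n * (g 4 * g 2)) $ M" by (simp add: r_def diff_divide_distrib)
      also have "g 4 * g 2 = (\<Prod>i<n. g (\<alpha> i))"
      proof -
        have "((\<lambda>_. 0)(u := 4)) v = (0::nat)" using 42 by simp
        then show ?thesis
          using 42 by (simp add: prod_fun_upd g_0 mult.commute del: fun_upd_apply)
      qed
      finally show ?thesis unfolding moment_normalized by (rule sym)
    next
      case 222
      have "(\<Sum>l<n. real (\<alpha> l * (\<alpha> l - 1)) * b (\<alpha>(l := \<alpha> l - 2))) =
          (\<Sum>l\<in>{i, j, k}. real (\<alpha> l * (\<alpha> l - 1)) * b (\<alpha>(l := \<alpha> l - 2)))"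
        using 222 i(1) j(1) k(1) by (intro sum_restrict) auto
      also have "\<dots> = 6 * r" using 222 by (auto simp: b_def)
      also have "\<dots> = (G 0 ^ n * g 2 ^ 3) $ M" using r 222 i(1) j(1) k(1) by auto
      also have "g 2 ^ 3 = (\<Prod>i<n. g (\<alpha> i))"
      proof -
        have "((\<lambda>_. 0)(k := 2)) j = (0::nat)" "((\<lambda>_. 0)(k := 2, j := 2)) i = (0::nat)" using 222 by auto
        then show ?thesis
          using 222(4) i(1) j(1) k(1) by (simp add: prod_fun_upd g_0 power3_eq_cube mult.assoc del: fun_upd_apply)
      qed
      finally show ?thesis unfolding moment_normalized by (rule sym)
    qed
  qed (rule moment_odd)
qed

end

section \<open>Shells of Z^n and of its shadow, treated together by an offset\<close>

definition lattice_shell :: "real \<Rightarrow> nat \<Rightarrow> real \<Rightarrow> (nat \<Rightarrow> real) set" where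
  "lattice_shell \<delta> n m = {x. (\<forall>i<n. x i - \<delta> \<in> \<int>) \<and> (\<forall>i\<ge>n. x i = 0) \<and> (\<Sum>i<n. (x i)^2) = m}"

lemma cubic_shell_eq: "cubic_shell n m = lattice_shell 0 n m"
  by (simp add: cubic_shell_def lattice_shell_def)

lemma shadow_shell_eq: "shadow_shell n m = lattice_shell (1/2) n m"
  by (simp add: shadow_shell_def lattice_shell_def)

definition int_vectors :: "nat \<Rightarrow> (nat \<Rightarrow> int) set" where
  "int_vectors n = {k. \<forall>i\<ge>n. k i = 0}"

lemma gen_fun_prod:
  assumes "finite_fibres UNIV N"
  shows "finite_fibres (int_vectors n) (\<lambda>k. \<Sum>i<n. N (k i))"
    and "(\<Prod>i<n. gen_fun UNIV N (w i)) =
      gen_fun (int_vectors n) (\<lambda>k. \<Sum>i<n. N (k i)) (\<lambda>k. \<Prod>i<n. w i (k i))"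
proof (induction n)
  case 0
  have "int_vectors 0 = {\<lambda>_. 0}" by (auto simp: int_vectors_def)
  moreover have "{x. x = (\<lambda>_. 0 :: int) \<and> 0 = n} = (if n = 0 then {\<lambda>_. 0} else {})" for n :: nat by auto
  ultimately show "finite_fibres (int_vectors 0) (\<lambda>k. \<Sum>i<0. N (k i))"
    "(\<Prod>i<0. gen_fun UNIV N (w i)) = gen_fun (int_vectors 0) (\<lambda>k. \<Sum>i<0. N (k i)) (\<lambda>k. \<Prod>i<0. w i (k i))"
    by (auto simp: finite_fibres_def fps_eq_iff gen_fun_nth)
next
  case (Suc n)
  let ?h = "\<lambda>(k :: nat \<Rightarrow> int, l). k(n := l)"
  let ?N = "\<lambda>n k. \<Sum>i<n. N (k i :: int)"
  have bij: "bij_betw ?h (int_vectors n \<times> UNIV) (int_vectors (Suc n))"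
    by (rule bij_betw_byWitness[where f' = "\<lambda>k. (k(n := 0), k n)"])
      (auto simp: int_vectors_def fun_eq_iff)
  have N: "?N n (fst p) + N (snd p) = ?N (Suc n) (?h p)" for p
    by (cases p) simp
  have ff: "finite_fibres (int_vectors n \<times> UNIV) (\<lambda>(k, l). ?N n k + N l)"
    by (rule finite_fibres_Times[OF Suc.IH(1) assms])
  show "finite_fibres (int_vectors (Suc n)) (?N (Suc n))"
    unfolding finite_fibres_def
  proof
    fix m
    have "{k. k \<in> int_vectors (Suc n) \<and> ?N (Suc n) k = m} \<subseteq>
        ?h ` {p. p \<in> int_vectors n \<times> UNIV \<and> (\<lambda>(k, l). ?N n k + N l) p = m}"
    proof
      fix k assume k: "k \<in> {k. k \<in> int_vectors (Suc n) \<and> ?N (Suc n) k = m}"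
      then have "k \<in> ?h ` (int_vectors n \<times> UNIV)" using bij unfolding bij_betw_def by blast
      then obtain k' l where p: "k' \<in> int_vectors n" "k = k'(n := l)" by auto
      from k p(2) have "?N (Suc n) (k'(n := l)) = m" by blast
      then have "?N n k' + N l = m" using N[of "(k', l)"] by (simp only: fst_conv snd_conv case_prod_conv)
      with p show "k \<in> ?h ` {p. p \<in> int_vectors n \<times> UNIV \<and> (\<lambda>(k, l). ?N n k + N l) p = m}"
        by (intro image_eqI[of _ _ "(k', l)"]) auto
    qed
    then show "finite {k. k \<in> int_vectors (Suc n) \<and> ?N (Suc n) k = m}"
      by (rule finite_subset) (rule finite_imageI, rule ff[unfolded finite_fibres_def, THEN spec])
  qed
  have "(\<Prod>i<Suc n. gen_fun UNIV N (w i)) =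
      gen_fun (int_vectors n) (?N n) (\<lambda>k. \<Prod>i<n. w i (k i)) * gen_fun UNIV N (w n)"
    using Suc.IH(2) by simp
  also have "\<dots> = gen_fun (int_vectors n \<times> UNIV) (\<lambda>(k, l). ?N n k + N l) (\<lambda>(k, l). (\<Prod>i<n. w i (k i)) * w n l)"
    by (rule gen_fun_mult[OF Suc.IH(1) assms])
  also have "\<dots> = gen_fun (int_vectors (Suc n)) (?N (Suc n)) (\<lambda>k. \<Prod>i<Suc n. w i (k i))"
    by (rule gen_fun_bij[OF bij]) auto
  finally show "(\<Prod>i<Suc n. gen_fun UNIV N (w i)) =
      gen_fun (int_vectors (Suc n)) (?N (Suc n)) (\<lambda>k. \<Prod>i<Suc n. w i (k i))" .
qed

text \<open>N is the squared coordinate less \<delta>^2, so the exponent M corresponds to norm M + n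
  \<delta>^2, which is M + n/4 for the shadow.\<close>

lemma lattice_shell_bij:
  assumes N: "\<And>k. (of_int k + \<delta>)\<^sup>2 = real (N k) + \<delta>\<^sup>2"
  shows "bij_betw (\<lambda>k i. if i < n then of_int (k i) + \<delta> else 0)
    {k. k \<in> int_vectors n \<and> (\<Sum>i<n. N (k i)) = M} (lattice_shell \<delta> n (real M + real n * \<delta>\<^sup>2))"
proof -
  have norm: "(\<Sum>i<n. (of_int (k i) + \<delta>)\<^sup>2) = real (\<Sum>i<n. N (k i)) + real n * \<delta>\<^sup>2" for k
    by (simp add: N sum.distrib)
  show ?thesis
  proof (rule bij_betw_byWitness[where f' = "\<lambda>x i. if i < n then \<lfloor>x i - \<delta>\<rfloor> else 0"])
    show "(\<lambda>k i. if i < n then of_int (k i) + \<delta> else 0) ` {k. k \<in> int_vectors n \<and> (\<Sum>i<n. N (k i)) = M}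
        \<subseteq> lattice_shell \<delta> n (real M + real n * \<delta>\<^sup>2)"
      using norm by (auto simp: lattice_shell_def)
    show "(\<lambda>x i. if i < n then \<lfloor>x i - \<delta>\<rfloor> else 0) ` lattice_shell \<delta> n (real M + real n * \<delta>\<^sup>2)
        \<subseteq> {k. k \<in> int_vectors n \<and> (\<Sum>i<n. N (k i)) = M}"
    proof (rule image_subsetI)
      fix x assume x: "x \<in> lattice_shell \<delta> n (real M + real n * \<delta>\<^sup>2)"
      have "(\<Sum>i<n. (of_int \<lfloor>x i - \<delta>\<rfloor> + \<delta>)\<^sup>2) = (\<Sum>i<n. (x i)\<^sup>2)"
        using x by (intro sum.cong) (auto simp: lattice_shell_def)
      then have "real (\<Sum>i<n. N \<lfloor>x i - \<delta>\<rfloor>) = real M"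
        using x norm[of "\<lambda>i. \<lfloor>x i - \<delta>\<rfloor>"] by (simp add: lattice_shell_def)
      then show "(\<lambda>i. if i < n then \<lfloor>x i - \<delta>\<rfloor> else 0) \<in> {k. k \<in> int_vectors n \<and> (\<Sum>i<n. N (k i)) = M}"
        by (simp only: of_nat_eq_iff) (simp add: int_vectors_def)
    qed
  qed (auto simp: int_vectors_def lattice_shell_def fun_eq_iff)
qed

lemma lattice_shell_norm:
  assumes N: "\<And>k. (of_int k + \<delta>)\<^sup>2 = real (N k) + \<delta>\<^sup>2" and x: "x \<in> lattice_shell \<delta> n m"
  shows "m = real (\<Sum>i<n. N \<lfloor>x i - \<delta>\<rfloor>) + real n * \<delta>\<^sup>2"
proof -
  have "m = (\<Sum>i<n. (x i)\<^sup>2)" using x by (simp add: lattice_shell_def)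
  also have "\<dots> = (\<Sum>i<n. (of_int \<lfloor>x i - \<delta>\<rfloor> + \<delta>)\<^sup>2)"
    using x by (intro sum.cong) (auto simp: lattice_shell_def)
  finally show ?thesis by (simp add: N sum.distrib)
qed

lemma lattice_shell_moment:
  assumes "finite_fibres UNIV N" and N: "\<And>k. (of_int k + \<delta>)\<^sup>2 = real (N k) + \<delta>\<^sup>2"
  shows "(\<Sum>x\<in>lattice_shell \<delta> n (real M + real n * \<delta>\<^sup>2). \<Prod>i<n. x i ^ \<alpha> i) =
    (\<Prod>i<n. gen_fun UNIV N (\<lambda>k. (of_int k + \<delta>) ^ \<alpha> i)) $ M"
  unfolding gen_fun_prod(2)[OF assms(1)] gen_fun_nth
  by (subst sum.reindex_bij_betw[OF lattice_shell_bij[OF N], symmetric]) simp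

lemma lattice_shell_finite:
  assumes "finite_fibres UNIV N" and N: "\<And>k. (of_int k + \<delta>)\<^sup>2 = real (N k) + \<delta>\<^sup>2"
  shows "finite (lattice_shell \<delta> n (real M + real n * \<delta>\<^sup>2))"
  using bij_betw_finite[OF lattice_shell_bij[OF N, of n M]] gen_fun_prod(1)[OF assms(1), of n]
  by (simp add: finite_fibres_def)

lemma lattice_shell_antipodal:
  assumes "2 * \<delta> \<in> \<int>" "finite (lattice_shell \<delta> n m)" "lattice_shell \<delta> n m \<noteq> {}"
  shows "antipodal_spherical n (lattice_shell \<delta> n m)"
proof -
  have "- t - \<delta> \<in> \<int>" if "t - \<delta> \<in> \<int>" for t
  proof -
    have "- t - \<delta> = - ((t - \<delta>) + 2 * \<delta>)" by simp
    then show ?thesis using that assms(1) by (metis Ints_add Ints_minus)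
  qed
  then show ?thesis
    using assms(2,3) unfolding antipodal_spherical_def by (auto simp: lattice_shell_def)
qed

section \<open>Sums of four squares\<close>

definition four_squares :: "int \<Rightarrow> bool" where
  "four_squares n \<longleftrightarrow> (\<exists>a b c d. n = a\<^sup>2 + b\<^sup>2 + c\<^sup>2 + d\<^sup>2)"

text \<open>Multiplicativity of the quaternion norm with one factor conjugated: the last three
  brackets vanish when the two vectors coincide, which the descent exploits modulo m.\<close>

lemma euler_four_square:
  fixes a b c d w x y z :: int
  shows "(a\<^sup>2 + b\<^sup>2 + c\<^sup>2 + d\<^sup>2) * (w\<^sup>2 + x\<^sup>2 + y\<^sup>2 + z\<^sup>2) =
    (a * w + b * x + c * y + d * z)\<^sup>2 + (a * x - b * w + c * z - d * y)\<^sup>2 +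
    (a * y - b * z - c * w + d * x)\<^sup>2 + (a * z + b * y - c * x - d * w)\<^sup>2"
  by (simp add: power2_eq_square algebra_simps)

lemma four_squares_mult: "four_squares m \<Longrightarrow> four_squares n \<Longrightarrow> four_squares (m * n)"
  unfolding four_squares_def using euler_four_square by metis

lemma four_squares_half:
  assumes "four_squares (2 * n)"
  shows "four_squares n"
proof -
  obtain a b c d where n: "2 * n = a\<^sup>2 + b\<^sup>2 + c\<^sup>2 + d\<^sup>2" using assms by (auto simp: four_squares_def)
  \<comment> \<open>Half of a^2 + b^2 is ((a + b)/2)^2 + ((a - b)/2)^2 for a, b of equal parity; an
    even total allows such a pairing.\<close>
  have *: "four_squares n" if n: "2 * n = a\<^sup>2 + b\<^sup>2 + c\<^sup>2 + d\<^sup>2" and e: "even (a - b)" "even (c - d)" for a b c d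
  proof -
    obtain s t where s: "a = b + 2 * s" "c = d + 2 * t"
      using e by (metis add_diff_cancel_left' diff_add_cancel add.commute evenE)
    have "n = (b + s)\<^sup>2 + s\<^sup>2 + (d + t)\<^sup>2 + t\<^sup>2"
      using n by (simp add: s power2_eq_square algebra_simps)
    then show ?thesis unfolding four_squares_def by blast
  qed
  have "even (a\<^sup>2 + b\<^sup>2 + c\<^sup>2 + d\<^sup>2)" by (simp flip: n)
  then have "even (a + b + c + d)" by simp
  then consider "even (a - b)" "even (c - d)" | "even (a - c)" "even (b - d)" | "even (a - d)" "even (b - c)"
    by auto
  then show ?thesis
    using *[OF n] *[of a c b d] *[of a d b c] n by cases (auto simp: algebra_simps)
qed

text \<open>For odd m the bound is strict, which is what makes the descent decrease.\<close>

lemma balanced_residue: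
  fixes x m :: int
  assumes "odd m" "m > 0"
  obtains y where "m dvd x - y" "2 * \<bar>y\<bar> < m"
proof -
  obtain h where h: "m = 2 * h + 1" using assms(1) by (elim oddE)
  have "x - ((x + h) mod m - h) = (x + h) - (x + h) mod m" by simp
  then have "m dvd x - ((x + h) mod m - h)" by (simp only: dvd_minus_mod)
  moreover have "0 \<le> (x + h) mod m" "(x + h) mod m < m" using assms(2) by auto
  ultimately show thesis by (intro that[of "(x + h) mod m - h"]) (auto simp: h)
qed

text \<open>Reduce the four coordinates modulo m to residues below m/2. Their squares sum to m r
  with r < m. In Euler's identity for (m p) (m r) all four brackets are divisible by m, and dividing
  by m^2 represents r p.\<close>

lemma four_squares_descent:
  fixes m p :: int
  assumes "prime p" "odd m" "1 < m" "m < p" "four_squares (m * p)"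
  obtains r where "0 < r" "r < m" "four_squares (r * p)"
proof -
  obtain a b c d where x: "m * p = a\<^sup>2 + b\<^sup>2 + c\<^sup>2 + d\<^sup>2" using assms(5) by (auto simp: four_squares_def)
  have m: "m > 0" using assms by simp
  obtain w where w: "m dvd a - w" "2 * \<bar>w\<bar> < m" by (rule balanced_residue[OF assms(2) m])
  obtain x' where x': "m dvd b - x'" "2 * \<bar>x'\<bar> < m" by (rule balanced_residue[OF assms(2) m])
  obtain y where y: "m dvd c - y" "2 * \<bar>y\<bar> < m" by (rule balanced_residue[OF assms(2) m])
  obtain z where z: "m dvd d - z" "2 * \<bar>z\<bar> < m" by (rule balanced_residue[OF assms(2) m])
  obtain w1 x1 y1 z1 where e: "a = w + m * w1" "b = x' + m * x1" "c = y + m * y1" "d = z + m * z1"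
    using w(1) x'(1) y(1) z(1) by (metis add.commute diff_add_cancel dvdE)
  let ?S = "w\<^sup>2 + x'\<^sup>2 + y\<^sup>2 + z\<^sup>2"
  have "m * p = ?S + m * (2 * w * w1 + m * w1\<^sup>2 + 2 * x' * x1 + m * x1\<^sup>2 + 2 * y * y1 + m * y1\<^sup>2 + 2 * z * z1 + m * z1\<^sup>2)"
    unfolding x e by (simp add: power2_eq_square algebra_simps)
  then have "?S = m * (p - (2 * w * w1 + m * w1\<^sup>2 + 2 * x' * x1 + m * x1\<^sup>2 + 2 * y * y1 + m * y1\<^sup>2 + 2 * z * z1 + m * z1\<^sup>2))"
    by (simp add: algebra_simps)
  then obtain r where r: "?S = m * r" by blast
  have sq: "4 * v\<^sup>2 < m\<^sup>2" if "2 * \<bar>v\<bar> < m" for v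
  proof -
    have "(2 * \<bar>v\<bar>)\<^sup>2 < m\<^sup>2" using that by (intro power_strict_mono) auto
    then show ?thesis by (simp add: power_mult_distrib)
  qed
  have "4 * ?S < 4 * m\<^sup>2" unfolding distrib_left using sq[OF w(2)] sq[OF x'(2)] sq[OF y(2)] sq[OF z(2)] by linarith
  then have "m * r < m * m" unfolding r by (simp add: power2_eq_square)
  then have "r < m" using m by simp
  \<comment> \<open>If r = 0, all coordinates are multiples of m, so m^2 divides m p, impossible for
    a prime p > m > 1.\<close>
  moreover have "r \<noteq> 0"
  proof
    assume "r = 0"
    then have "?S = 0" using r by simp
    then have "w = 0" "x' = 0" "y = 0" "z = 0"
      using zero_le_power2[of w] zero_le_power2[of x'] zero_le_power2[of y] zero_le_power2[of z]
      by (smt (verit) zero_eq_power2)+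
    then have "m * p = m * (m * (w1\<^sup>2 + x1\<^sup>2 + y1\<^sup>2 + z1\<^sup>2))"
      unfolding x e by (simp add: power2_eq_square algebra_simps)
    then have "m dvd p" using m by simp
    then show False using assms(1,3,4) by (metis not_le prime_int_iff zdvd_imp_le zero_less_one less_trans nat_neq_iff less_irrefl order_less_imp_le)
  qed
  moreover have "0 \<le> r"
  proof -
    have "0 \<le> m * r" unfolding r[symmetric] by simp
    then show ?thesis using m by (simp add: zero_le_mult_iff)
  qed
  moreover have "four_squares (r * p)"
  proof -
    obtain k1 where k1: "a * w + b * x' + c * y + d * z = m * k1"
    proof -
      have "a * w + b * x' + c * y + d * z = m * p - m * (a * w1 + b * x1 + c * y1 + d * z1)"
        unfolding x by (simp add: e power2_eq_square algebra_simps)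
      also have "\<dots> = m * (p - (a * w1 + b * x1 + c * y1 + d * z1))" by (simp add: algebra_simps)
      finally show thesis by (rule that)
    qed
    have k2: "a * x' - b * w + c * z - d * y = m * (w1 * x' - x1 * w + y1 * z - z1 * y)"
      "a * y - b * z - c * w + d * x' = m * (w1 * y - x1 * z - y1 * w + z1 * x')"
      "a * z + b * y - c * x' - d * w = m * (w1 * z + x1 * y - y1 * x' - z1 * w)"
      by (simp_all add: e algebra_simps)
    have "m\<^sup>2 * (r * p) = (m * p) * (m * r)" by (simp add: power2_eq_square)
    also have "\<dots> = (m * k1)\<^sup>2 + (m * (w1 * x' - x1 * w + y1 * z - z1 * y))\<^sup>2 +
        (m * (w1 * y - x1 * z - y1 * w + z1 * x'))\<^sup>2 + (m * (w1 * z + x1 * y - y1 * x' - z1 * w))\<^sup>2"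
      unfolding x r[symmetric] euler_four_square k1 k2 ..
    also have "\<dots> = m\<^sup>2 * (k1\<^sup>2 + (w1 * x' - x1 * w + y1 * z - z1 * y)\<^sup>2 +
        (w1 * y - x1 * z - y1 * w + z1 * x')\<^sup>2 + (w1 * z + x1 * y - y1 * x' - z1 * w)\<^sup>2)"
      unfolding power_mult_distrib distrib_left[of "m\<^sup>2"] ..
    finally show ?thesis using m unfolding four_squares_def by auto
  qed
  ultimately show thesis by (intro that[of r]) auto
qed

lemma four_squares_prime_multiple:
  fixes m p :: int
  assumes "prime p"
  shows "0 < m \<Longrightarrow> m < p \<Longrightarrow> four_squares (m * p) \<Longrightarrow> four_squares p"
proof (induction "nat m" arbitrary: m rule: less_induct)
  case less
  consider "m = 1" | "even m" | "odd m" "m > 1" using less.prems(1) by fastforce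
  then show ?case
  proof cases
    case 1
    then show ?thesis using less.prems by simp
  next
    case 2
    then obtain k where k: "m = 2 * k" by (elim evenE)
    then have "four_squares (k * p)" using four_squares_half[of "k * p"] less.prems(3) by (simp add: mult.assoc)
    then show ?thesis using less.hyps[of k] less.prems k by simp
  next
    case 3
    then obtain r where "0 < r" "r < m" "four_squares (r * p)"
      using four_squares_descent[OF assms 3(1,2) less.prems(2,3)] by blast
    then show ?thesis using less.hyps[of r] less.prems by simp
  qed
qed

text \<open>Pigeonhole: the h + 1 residues of a^2 and the h + 1 residues of -1 - b^2 cannot be
  disjoint among 2 h + 1 classes.\<close>

lemma prime_dvd_sum_squares_plus_1:
  fixes p h :: int
  assumes p: "prime p" "p = 2 * h + 1"
  obtains a b where "0 \<le> a" "a \<le> h" "0 \<le> b" "b \<le> h" "p dvd a\<^sup>2 + b\<^sup>2 + 1"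
proof -
  have p0: "p > 1" "h \<ge> 0" using p prime_gt_1_int[of p] by auto
  have inj: "a = b" if "0 \<le> a" "a \<le> h" "0 \<le> b" "b \<le> h" "p dvd a\<^sup>2 - b\<^sup>2" for a b
  proof -
    have "p dvd (a - b) * (a + b)" using that(5) by (simp add: power2_eq_square algebra_simps)
    then consider "p dvd a - b" | "p dvd a + b" using p(1) by (auto simp: prime_dvd_mult_iff)
    then show ?thesis
    proof cases
      case 1
      then have "p dvd b - a" by (simp add: dvd_diff_commute)
      with 1 show ?thesis using that p(2) zdvd_imp_le[of p "a - b"] zdvd_imp_le[of p "b - a"] by linarith
    next
      case 2
      then show ?thesis using that p(2) zdvd_imp_le[of p "a + b"] by fastforce
    qed
  qed
  let ?f = "\<lambda>a. a\<^sup>2 mod p" and ?g = "\<lambda>b. (- 1 - b\<^sup>2) mod p"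
  have f: "inj_on ?f {0..h}" by (auto intro!: inj_onI inj simp: mod_eq_dvd_iff)
  have g: "inj_on ?g {0..h}"
  proof (rule inj_onI)
    fix a b assume ab: "a \<in> {0..h}" "b \<in> {0..h}" "?g a = ?g b"
    then have "p dvd b\<^sup>2 - a\<^sup>2" by (simp add: mod_eq_dvd_iff)
    then show "a = b" using ab inj[of b a] by auto
  qed
  have "?f ` {0..h} \<inter> ?g ` {0..h} \<noteq> {}"
  proof
    assume "?f ` {0..h} \<inter> ?g ` {0..h} = {}"
    then have "card (?f ` {0..h} \<union> ?g ` {0..h}) = card (?f ` {0..h}) + card (?g ` {0..h})"
      by (intro card_Un_disjoint) auto
    also have "\<dots> = 2 * nat (h + 1)" using f g by (simp add: card_image)
    finally have "card (?f ` {0..h} \<union> ?g ` {0..h}) = 2 * nat (h + 1)" .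
    moreover have "card (?f ` {0..h} \<union> ?g ` {0..h}) \<le> card {0..<p}"
      using p0 by (intro card_mono) auto
    ultimately show False using p p0 by simp
  qed
  then obtain a b where ab: "a \<in> {0..h}" "b \<in> {0..h}" "?f a = ?g b" by blast
  then have "p dvd a\<^sup>2 - (- 1 - b\<^sup>2)" by (simp only: mod_eq_dvd_iff)
  then have "p dvd a\<^sup>2 + b\<^sup>2 + 1" by (simp add: algebra_simps)
  with ab show thesis by (intro that[of a b]) auto
qed

lemma four_squares_prime:
  fixes p :: int
  assumes "prime p"
  shows "four_squares p"
proof (cases "p = 2")
  case True
  have "(2::int) = 1\<^sup>2 + 1\<^sup>2 + 0\<^sup>2 + 0\<^sup>2" by simp
  then show ?thesis unfolding True four_squares_def by blast
next
  case False
  then have "p > 2" using prime_gt_1_int[OF assms] by simp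
  with assms have "odd p" by (rule prime_odd_int)
  then obtain h where h: "p = 2 * h + 1" by (elim oddE)
  obtain a b where ab: "0 \<le> a" "a \<le> h" "0 \<le> b" "b \<le> h" "p dvd a\<^sup>2 + b\<^sup>2 + 1"
    by (rule prime_dvd_sum_squares_plus_1[OF assms h])
  then obtain m where m: "a\<^sup>2 + b\<^sup>2 + 1 = m * p" by (metis dvdE mult.commute)
  have p: "p > 1" using assms by (rule prime_gt_1_int)
  have "a\<^sup>2 \<le> h\<^sup>2" "b\<^sup>2 \<le> h\<^sup>2" using ab by (auto intro: power_mono)
  then have "m * p \<le> 2 * h\<^sup>2 + 1" by (simp flip: m)
  also have "\<dots> < p * p"
  proof -
    have "h > 0" using p h by simp
    moreover have "p * p = 2 * h\<^sup>2 + (2 * h\<^sup>2 + 4 * h + 1)"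
      by (simp add: h power2_eq_square algebra_simps)
    ultimately show ?thesis using zero_le_power2[of h] by linarith
  qed
  finally have "m < p" using p by simp
  moreover have "0 < m * p" unfolding m[symmetric] by (simp add: add_nonneg_pos)
  then have "0 < m" using p by (simp add: zero_less_mult_iff)
  moreover have "four_squares (m * p)"
    unfolding four_squares_def using m by (metis add.right_neutral one_power2 power_zero_numeral)
  ultimately show ?thesis using four_squares_prime_multiple[OF assms] by blast
qed

theorem lagrange_four_squares: "four_squares (int n)"
proof (induction n rule: less_induct)
  case (less n)
  consider "n = 0" | "n = 1" | "n > 1" by linarith
  then show ?case
  proof cases
    case 1
    have "int n = 0\<^sup>2 + 0\<^sup>2 + 0\<^sup>2 + 0\<^sup>2" using 1 by simp
    then show ?thesis unfolding four_squares_def by blast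
  next
    case 2
    have "int n = 1\<^sup>2 + 0\<^sup>2 + 0\<^sup>2 + 0\<^sup>2" using 2 by simp
    then show ?thesis unfolding four_squares_def by blast
  next
    case 3
    then obtain p where p: "prime p" "p dvd n" using prime_factor_nat[of n] by auto
    then obtain k where k: "n = p * k" by blast
    moreover have "k > 0" using 3 k by (cases k) auto
    ultimately have "k < n" using prime_gt_1_nat[OF p(1)] by simp
    then have "four_squares (int k)" by (rule less.IH)
    moreover have "four_squares (int p)" using p by (intro four_squares_prime) simp
    ultimately show ?thesis unfolding k using four_squares_mult by simp
  qed
qed

section \<open>The shells\<close>

lemma int_norm: "(of_int k + 0)\<^sup>2 = real (nat (k * k)) + 0\<^sup>2" for k :: int
  by (simp add: power2_eq_square)

lemma half_norm: "(of_int k + 1/2)\<^sup>2 = real (nat (k * (k + 1))) + (1/2)\<^sup>2" for k :: int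
proof -
  have "real (nat (k * (k + 1))) = of_int k * (of_int k + 1)"
    using pronic_nonneg[of k] by simp
  then show ?thesis by (simp add: power2_eq_square field_simps)
qed

lemma cubic_shell_moment:
  "(\<Sum>x\<in>cubic_shell n (real M). \<Prod>i<n. x i ^ \<alpha> i) = (\<Prod>i<n. int_theta (\<alpha> i)) $ M"
  using lattice_shell_moment[OF finite_fibres_int int_norm, where n = n and M = M and \<alpha> = \<alpha>]
  by (simp add: cubic_shell_eq int_theta_def)

lemma shadow_shell_moment:
  "(\<Sum>x\<in>shadow_shell n (real M + real n / 4). \<Prod>i<n. x i ^ \<alpha> i) = (\<Prod>i<n. half_theta (\<alpha> i)) $ M"
  using lattice_shell_moment[OF finite_fibres_half half_norm, where n = n and M = M and \<alpha> = \<alpha>]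
  by (simp add: shadow_shell_eq half_theta_def power2_eq_square)

lemma cubic_shell_antipodal:
  assumes "cubic_shell n (real M) \<noteq> {}"
  shows "antipodal_spherical n (cubic_shell n (real M))"
  using assms lattice_shell_finite[OF finite_fibres_int int_norm, of n M]
  unfolding cubic_shell_eq by (intro lattice_shell_antipodal) auto

lemma shadow_shell_antipodal:
  assumes "shadow_shell n (real M + real n / 4) \<noteq> {}"
  shows "antipodal_spherical n (shadow_shell n (real M + real n / 4))"
  using assms lattice_shell_finite[OF finite_fibres_half half_norm, of n M]
  unfolding shadow_shell_eq by (intro lattice_shell_antipodal) (auto simp: power2_eq_square)

lemma cubic_shell_norm:
  assumes "cubic_shell n m \<noteq> {}"
  obtains M where "m = real M"
proof -
  obtain x where "x \<in> lattice_shell 0 n m" using assms by (auto simp: cubic_shell_eq)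
  from lattice_shell_norm[OF int_norm this] show thesis
    by (intro that[of "\<Sum>i<n. nat (\<lfloor>x i - 0\<rfloor> * \<lfloor>x i - 0\<rfloor>)"]) simp
qed

lemma shadow_shell_norm:
  assumes "shadow_shell n m \<noteq> {}"
  obtains M where "m = real M + real n / 4"
proof -
  obtain x where "x \<in> lattice_shell (1/2) n m" using assms by (auto simp: shadow_shell_eq)
  from lattice_shell_norm[OF half_norm this] show thesis
    by (intro that[of "\<Sum>i<n. nat (\<lfloor>x i - 1/2\<rfloor> * (\<lfloor>x i - 1/2\<rfloor> + 1))"]) (simp add: power2_eq_square)
qed

lemma int_theta_ratio: "int_theta j = int_theta j * inverse theta3 * theta3"
  "int_theta 0 * inverse theta3 = 1"
  by (simp_all add: mult.assoc inverse_mult_eq_1 inverse_mult_eq_1' theta3_nth_0)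

lemma half_theta_ratio: "half_theta j = half_theta j * inverse theta2 * theta2"
  "half_theta 0 * inverse theta2 = 1"
  by (simp_all add: mult.assoc inverse_mult_eq_1 inverse_mult_eq_1' theta2_nth_0)

lemma cubic_design_cond_2: "design_cond n (cubic_shell n (real M)) 2"
  by (rule design_cond_2[where G = int_theta and g = "\<lambda>j. int_theta j * inverse theta3" and M = M])
    (rule cubic_shell_moment int_theta_odd int_theta_ratio; assumption?)+

lemma shadow_design_cond_2: "design_cond n (shadow_shell n (real M + real n / 4)) 2"
  by (rule design_cond_2[where G = half_theta and g = "\<lambda>j. half_theta j * inverse theta2" and M = M])
    (rule shadow_shell_moment half_theta_odd half_theta_ratio; assumption?)+

lemma cubic_ratios:
  "int_theta 2 * inverse theta3 = dlog3"
  "int_theta 4 * inverse theta3 = fps_XD dlog3 + dlog3 ^ 2"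
  "int_theta 6 * inverse theta3 = fps_XD (fps_XD dlog3) + 3 * dlog3 * fps_XD dlog3 + dlog3 ^ 3"
  using int_theta_ratio(2) by (simp_all add: int_theta_2 int_theta_4 int_theta_6 mult.assoc)

lemma shadow_ratios:
  "half_theta 2 * inverse theta2 = dlog2"
  "half_theta 4 * inverse theta2 = fps_XD dlog2 + dlog2 ^ 2"
  "half_theta 6 * inverse theta2 = fps_XD (fps_XD dlog2) + 3 * dlog2 * fps_XD dlog2 + dlog2 ^ 3"
  using half_theta_ratio(2) by (simp_all add: half_theta_2 half_theta_4 half_theta_6 mult.assoc)

lemma nth_8_eq_0: "(8 * f) $ M = 0 \<Longrightarrow> f $ M = 0" for f :: "real fps"
  by (simp add: numeral_fps_const)

lemma cubic_design_cond_4: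
  assumes "(theta3 ^ n * (tx * ty)) $ M = 0"
  shows "design_cond n (cubic_shell n (real M)) 4"
proof (rule design_cond_4[where G = int_theta and g = "\<lambda>j. int_theta j * inverse theta3" and M = M])
  have "8 * (theta3 ^ n * (fps_XD dlog3 + dlog3 ^ 2 - 3 * dlog3 ^ 2)) = theta3 ^ n * (tx * ty)"
    unfolding dlog3_quartic[symmetric] by (simp add: algebra_simps)
  then have "(8 * (theta3 ^ n * (fps_XD dlog3 + dlog3 ^ 2 - 3 * dlog3 ^ 2))) $ M = 0"
    using assms by (simp only:)
  then show "(theta3 ^ n * (int_theta 4 * inverse theta3 - 3 * (int_theta 2 * inverse theta3) ^ 2)) $ M = 0"
    unfolding cubic_ratios by (rule nth_8_eq_0)
qed (rule cubic_shell_moment int_theta_odd int_theta_ratio; assumption?)+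

lemma shadow_design_cond_4:
  assumes "(theta2 ^ n * (ty * tz)) $ M = 0"
  shows "design_cond n (shadow_shell n (real M + real n / 4)) 4"
proof (rule design_cond_4[where G = half_theta and g = "\<lambda>j. half_theta j * inverse theta2" and M = M])
  have "8 * (theta2 ^ n * (fps_XD dlog2 + dlog2 ^ 2 - 3 * dlog2 ^ 2)) =
      theta2 ^ n * (8 * (fps_XD dlog2 - 2 * dlog2 ^ 2))"
    by (simp add: algebra_simps)
  also have "\<dots> = - (theta2 ^ n * (ty * tz))" unfolding dlog2_quartic by simp
  finally have "(8 * (theta2 ^ n * (fps_XD dlog2 + dlog2 ^ 2 - 3 * dlog2 ^ 2))) $ M = 0"
    using assms by (simp only: fps_neg_nth minus_zero)
  then show "(theta2 ^ n * (half_theta 4 * inverse theta2 - 3 * (half_theta 2 * inverse theta2) ^ 2)) $ M = 0"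
    unfolding shadow_ratios by (rule nth_8_eq_0)
qed (rule shadow_shell_moment half_theta_odd half_theta_ratio; assumption?)+

lemma cubic_design_cond_6:
  assumes "n = 2 \<or> (theta3 ^ n * (tx * ty * (ty - tx))) $ M = 0"
  shows "design_cond n (cubic_shell n (real M)) 6"
proof (rule design_cond_6[where G = int_theta and g = "\<lambda>j. int_theta j * inverse theta3" and M = M])
  let ?s = "fps_XD (fps_XD dlog3) + 3 * dlog3 * fps_XD dlog3 + dlog3 ^ 3
      - 15 * (fps_XD dlog3 + dlog3 ^ 2) * dlog3 + 30 * dlog3 ^ 3"
  \<comment> \<open>The constants 15 and 30 of \<open>design_cond_6\<close> produce exactly the
    expression evaluated in \<open>dlog3_sextic\<close>.\<close>
  have s: "?s = fps_XD (fps_XD dlog3) - 12 * dlog3 * fps_XD dlog3 + 16 * dlog3 ^ 3"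
    by (simp add: power2_eq_square power3_eq_cube algebra_simps)
  have "8 * (theta3 ^ n * ?s) = theta3 ^ n * (tx * ty * (ty - tx))"
    unfolding s dlog3_sextic[symmetric] by (rule mult.left_commute)
  then have "n = 2 \<or> (8 * (theta3 ^ n * ?s)) $ M = 0" using assms by (simp only:)
  then have "n = 2 \<or> (theta3 ^ n * ?s) $ M = 0" by (blast intro: nth_8_eq_0[of "theta3 ^ n * ?s" M])
  then show "n = 2 \<or> (theta3 ^ n * (int_theta 6 * inverse theta3
      - 15 * (int_theta 4 * inverse theta3) * (int_theta 2 * inverse theta3)
      + 30 * (int_theta 2 * inverse theta3) ^ 3)) $ M = 0"
    unfolding cubic_ratios .
qed (rule cubic_shell_moment int_theta_odd int_theta_ratio; assumption?)+

lemma shadow_design_cond_6: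
  assumes "n = 2 \<or> (theta2 ^ n * (ty * tz * (ty + tz))) $ M = 0"
  shows "design_cond n (shadow_shell n (real M + real n / 4)) 6"
proof (rule design_cond_6[where G = half_theta and g = "\<lambda>j. half_theta j * inverse theta2" and M = M])
  let ?s = "fps_XD (fps_XD dlog2) + 3 * dlog2 * fps_XD dlog2 + dlog2 ^ 3
      - 15 * (fps_XD dlog2 + dlog2 ^ 2) * dlog2 + 30 * dlog2 ^ 3"
  have s: "?s = fps_XD (fps_XD dlog2) - 12 * dlog2 * fps_XD dlog2 + 16 * dlog2 ^ 3"
    by (simp add: power2_eq_square power3_eq_cube algebra_simps)
  have "8 * (theta2 ^ n * ?s) = theta2 ^ n * (ty * tz * (ty + tz))"
    unfolding s dlog2_sextic[symmetric] by (rule mult.left_commute)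
  then have "n = 2 \<or> (8 * (theta2 ^ n * ?s)) $ M = 0" using assms by (simp only:)
  then have "n = 2 \<or> (theta2 ^ n * ?s) $ M = 0" by (blast intro: nth_8_eq_0[of "theta2 ^ n * ?s" M])
  then show "n = 2 \<or> (theta2 ^ n * (half_theta 6 * inverse theta2
      - 15 * (half_theta 4 * inverse theta2) * (half_theta 2 * inverse theta2)
      + 30 * (half_theta 2 * inverse theta2) ^ 3)) $ M = 0"
    unfolding shadow_ratios .
qed (rule shadow_shell_moment half_theta_odd half_theta_ratio; assumption?)+

section \<open>From the conditions to designs\<close>

lemma sph_design_3I: "antipodal_spherical n X \<Longrightarrow> design_cond n X 2 \<Longrightarrow> sph_design n X 3"
proof -
  assume "antipodal_spherical n X" "design_cond n X 2"
  moreover have "j = 1" if "1 \<le> j" "2 * j \<le> 3" for j :: nat using that by linarith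
  ultimately show ?thesis unfolding sph_design_def by (metis mult_1_right)
qed

lemma sph_design_5I:
  assumes "antipodal_spherical n X" "design_cond n X 2" "design_cond n X 4"
  shows "sph_design n X 5"
proof -
  have "2 * j = 2 \<or> 2 * j = 4" if "1 \<le> j" "2 * j \<le> 5" for j :: nat using that by presburger
  then show ?thesis using assms unfolding sph_design_def by metis
qed

lemma sph_half_design_1I:
  assumes "antipodal_spherical n X" "design_cond n X 2" "design_cond n X 6"
  shows "sph_half_design n X 1"
proof -
  have "j = 1" if "1 \<le> j" "2 * j \<le> 2 * 1" for j :: nat using that by linarith
  moreover have "2 * 1 + 4 = (6::nat)" "2 * 1 = (2::nat)" by simp_all
  ultimately show ?thesis using assms unfolding sph_half_design_def by metis
qed

section \<open>Nonempty shells\<close>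

lemma real_four_squares:
  obtains a b c d :: int where "real M = (of_int a)\<^sup>2 + (of_int b)\<^sup>2 + (of_int c)\<^sup>2 + (of_int d)\<^sup>2"
proof -
  obtain a b c d where "int M = a\<^sup>2 + b\<^sup>2 + c\<^sup>2 + d\<^sup>2"
    using lagrange_four_squares[of M] unfolding four_squares_def by blast
  from arg_cong[OF this, of real_of_int] show thesis by (intro that) simp
qed

lemma cubic_shell_nonempty:
  assumes "4 \<le> n"
  shows "cubic_shell n (real M) \<noteq> {}"
proof -
  obtain a b c d :: int
    where M: "real M = (of_int a)\<^sup>2 + (of_int b)\<^sup>2 + (of_int c)\<^sup>2 + (of_int d)\<^sup>2"
    by (rule real_four_squares)
  define x where "x = (\<lambda>_::nat. 0 :: real)(0 := of_int a, 1 := of_int b, 2 := of_int c, 3 := of_int d)"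
  have "(\<Sum>i<n. (x i)\<^sup>2) = (\<Sum>i<4. (x i)\<^sup>2)"
    using assms by (intro sum.mono_neutral_right) (auto simp: x_def)
  also have "\<dots> = real M" by (simp add: M x_def lessThan_nat_numeral)
  finally have "x \<in> cubic_shell n (real M)" using assms by (auto simp: cubic_shell_def x_def)
  then show ?thesis by blast
qed

lemma shadow16_shell_nonempty: "shadow_shell 16 (2 * real M + 4) \<noteq> {}"
proof -
  obtain a b c d :: int
    where M: "real M = (of_int a)\<^sup>2 + (of_int b)\<^sup>2 + (of_int c)\<^sup>2 + (of_int d)\<^sup>2"
    by (rule real_four_squares)
  \<comment> \<open>The pair a + 1/2, a - 1/2 contributes 2 a^2 + 1/2, so four pairs give 2 M + 2;
    the eight coordinates 1/2 add 2.\<close>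
  define l where "l = [a, a - 1, b, b - 1, c, c - 1, d, d - 1]"
  define x where "x = (\<lambda>i. if i < 8 then of_int (l ! i) + 1/2 else if i < 16 then 1/2 else (0 :: real))"
  have "{..<16} = {..<8} \<union> {8..<16::nat}" by auto
  then have "(\<Sum>i<16. (x i)\<^sup>2) = (\<Sum>i<8. (x i)\<^sup>2) + (\<Sum>i\<in>{8..<16}. (x i)\<^sup>2)"
    by (metis finite_atLeastLessThan finite_lessThan ivl_disj_int_one(2) sum.union_disjoint)
  also have "(\<Sum>i\<in>{8..<16}. (x i)\<^sup>2) = (\<Sum>i\<in>{8..<16::nat}. 1/4)"
    by (rule sum.cong) (auto simp: x_def power2_eq_square)
  also have "(\<Sum>i<8. (x i)\<^sup>2) = 2 * real M + 2"
    by (simp add: x_def l_def M lessThan_nat_numeral power2_eq_square algebra_simps)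
  finally have "x \<in> shadow_shell 16 (2 * real M + 4)" by (auto simp: shadow_shell_def x_def)
  then show ?thesis by blast
qed

lemma shadow40_shell_nonempty: "shadow_shell 40 24 \<noteq> {}"
proof -
  \<comment> \<open>7 * 9/4 + 33 * 1/4 = 24.\<close>
  define x where "x = (\<lambda>i::nat. if i < 7 then 3/2 else if i < 40 then 1/2 else (0 :: real))"
  have "{..<40} = {..<7} \<union> {7..<40::nat}" by auto
  then have "(\<Sum>i<40. (x i)\<^sup>2) = (\<Sum>i<7. (x i)\<^sup>2) + (\<Sum>i\<in>{7..<40}. (x i)\<^sup>2)"
    by (metis finite_atLeastLessThan finite_lessThan ivl_disj_int_one(2) sum.union_disjoint)
  also have "(\<Sum>i<7. (x i)\<^sup>2) = (\<Sum>i<7::nat. 9/4)"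
    by (rule sum.cong) (auto simp: x_def power2_eq_square)
  also have "(\<Sum>i\<in>{7..<40}. (x i)\<^sup>2) = (\<Sum>i\<in>{7..<40::nat}. 1/4)"
    by (rule sum.cong) (auto simp: x_def power2_eq_square)
  finally have "x \<in> shadow_shell 40 24" by (auto simp: shadow_shell_def x_def)
  then show ?thesis by blast
qed

text \<open>In dimension 16 norm m belongs to exponent m - 4. The factor \<open>fps_X ^ 4\<close>
  absorbs this shift, so the results on \<open>tx ^ 4\<close> apply at m itself.\<close>

lemma tx_power_4: "tx ^ 4 * f = fps_X ^ 4 * (theta2 ^ 16 * f)"
  by (simp add: tx_def power_mult_distrib mult.assoc flip: power_mult)

theorem theorem9p2:
  shows
  "(\<forall>n m. n \<ge> 2 \<longrightarrow>
      (cubic_shell n m \<noteq> {} \<longrightarrow> sph_design n (cubic_shell n m) 3) \<and>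
      (shadow_shell n m \<noteq> {} \<longrightarrow> sph_design n (shadow_shell n m) 3))
   \<and>
   ((\<forall>m. cubic_shell 2 m \<noteq> {} \<longrightarrow> sph_half_design 2 (cubic_shell 2 m) 1) \<and>
    (\<forall>m. shadow_shell 2 m \<noteq> {} \<longrightarrow> sph_half_design 2 (shadow_shell 2 m) 1) \<and>
    (\<forall>a::nat. sph_half_design 16 (cubic_shell 16 (2 * 4 ^ a)) 1) \<and>
    (\<forall>a::nat. a \<ge> 1 \<longrightarrow> sph_half_design 16 (shadow_shell 16 (2 * 4 ^ a)) 1) \<and>
    sph_half_design 40 (shadow_shell 40 24) 1)
   \<and>
   ((\<forall>a::nat. a \<ge> 1 \<longrightarrow> sph_design 4 (cubic_shell 4 (2 * real a)) 5) \<and>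
    (\<forall>a b::nat. sph_design 7 (cubic_shell 7 (4 ^ a * (8 * real b + 3))) 5) \<and>
    (\<forall>a::nat. a \<ge> 1 \<longrightarrow> sph_design 16 (shadow_shell 16 (4 * real a + 2)) 5))"
proof (intro conjI allI impI)
  fix n m assume "cubic_shell n m \<noteq> {}"
  then obtain M where "m = real M" by (rule cubic_shell_norm)
  with \<open>cubic_shell n m \<noteq> {}\<close> show "sph_design n (cubic_shell n m) 3"
    by (simp add: sph_design_3I cubic_shell_antipodal cubic_design_cond_2)
next
  fix n m assume ne: "shadow_shell n m \<noteq> {}"
  then obtain M where m: "m = real M + real n / 4" by (rule shadow_shell_norm)
  show "sph_design n (shadow_shell n m) 3"
    using ne unfolding m by (intro sph_design_3I shadow_shell_antipodal shadow_design_cond_2)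
next
  fix m assume ne: "cubic_shell 2 m \<noteq> {}"
  then obtain M where m: "m = real M" by (rule cubic_shell_norm)
  show "sph_half_design 2 (cubic_shell 2 m) 1"
    using ne unfolding m
    by (intro sph_half_design_1I cubic_shell_antipodal cubic_design_cond_2 cubic_design_cond_6) auto
next
  fix m assume ne: "shadow_shell 2 m \<noteq> {}"
  then obtain M where m: "m = real M + real 2 / 4" by (rule shadow_shell_norm)
  show "sph_half_design 2 (shadow_shell 2 m) 1"
    using ne unfolding m
    by (intro sph_half_design_1I shadow_shell_antipodal shadow_design_cond_2 shadow_design_cond_6) auto
next
  fix a :: nat
  have m: "(2 * 4 ^ a :: real) = real (2 * 4 ^ a)" by simp
  have "(theta3 ^ 16 * (tx * ty * (ty - tx))) $ (2 * 4 ^ a) = 0"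
    using int_sextic_nth[of a] by (simp add: tz_def flip: power_mult)
  then show "sph_half_design 16 (cubic_shell 16 (2 * 4 ^ a)) 1"
    unfolding m
    by (intro sph_half_design_1I cubic_shell_antipodal cubic_design_cond_2 cubic_design_cond_6
        cubic_shell_nonempty) auto
next
  fix a :: nat assume a: "a \<ge> 1"
  \<comment> \<open>Norm minus 16/4; a \<ge> 1 makes the subtraction exact.\<close>
  define M :: nat where "M = 2 * 4 ^ a - 4"
  have "(4::nat) ^ 1 \<le> 4 ^ a" using a by (intro power_increasing) auto
  then have M: "2 * 4 ^ a = M + 4" "2 * 4 ^ a = 2 * (4 ^ a - 2 :: nat) + 4" by (auto simp: M_def)
  have m: "(2 * 4 ^ a :: real) = real M + real 16 / 4"
    using arg_cong[OF M(1), of real] by simp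
  have m': "(2 * 4 ^ a :: real) = 2 * real (4 ^ a - 2) + 4"
    using arg_cong[OF M(2), of real] by simp
  have "shadow_shell 16 (real M + real 16 / 4) \<noteq> {}"
    unfolding m[symmetric] unfolding m' by (rule shadow16_shell_nonempty)
  moreover have "(theta2 ^ 16 * (ty * tz * (ty + tz))) $ M = 0"
    using half_sextic_nth[of a] unfolding tx_power_4 M(1) by (simp add: fps_X_power_mult_nth)
  ultimately show "sph_half_design 16 (shadow_shell 16 (2 * 4 ^ a)) 1"
    unfolding m
    by (intro sph_half_design_1I shadow_shell_antipodal shadow_design_cond_2 shadow_design_cond_6) auto
next
  have m: "(24 :: real) = real 14 + real 40 / 4" by simp
  show "sph_half_design 40 (shadow_shell 40 24) 1"
    using shadow40_shell_nonempty shadow40_nth unfolding m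
    by (intro sph_half_design_1I shadow_shell_antipodal shadow_design_cond_2 shadow_design_cond_6) auto
next
  fix a :: nat
  have m: "2 * real a = real (2 * a)" by simp
  \<comment> \<open>\<open>theta3 ^ 4\<close> is \<open>tz\<close>, and \<open>tx * ty * tz\<close>
    is odd in q.\<close>
  have "(theta3 ^ 4 * (tx * ty)) $ (2 * a) = 0"
    using txyz_nth_even[of a] by (simp add: tz_def mult_ac)
  then show "sph_design 4 (cubic_shell 4 (2 * real a)) 5"
    unfolding m
    by (intro sph_design_5I cubic_shell_antipodal cubic_design_cond_2 cubic_design_cond_4
        cubic_shell_nonempty) auto
next
  fix a b :: nat
  have m: "4 ^ a * (8 * real b + 3) = real (4 ^ a * (8 * b + 3))" by simp
  show "sph_design 7 (cubic_shell 7 (4 ^ a * (8 * real b + 3))) 5"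
    using seven_form_nth[of a b] unfolding m seven_form_def
    by (intro sph_design_5I cubic_shell_antipodal cubic_design_cond_2 cubic_design_cond_4
        cubic_shell_nonempty) auto
next
  fix a :: nat assume a: "a \<ge> 1"
  define M where "M = 4 * a - 2"
  have M: "4 * a + 2 = M + 4" "4 * a + 2 = 2 * (2 * a - 1) + 4" using a by (auto simp: M_def)
  have m: "4 * real a + 2 = real M + real 16 / 4"
    using arg_cong[OF M(1), of real] by simp
  have m': "4 * real a + 2 = 2 * real (2 * a - 1) + 4"
    using arg_cong[OF M(2), of real] a by (simp add: of_nat_diff)
  have "shadow_shell 16 (real M + real 16 / 4) \<noteq> {}"
    unfolding m[symmetric] unfolding m' by (rule shadow16_shell_nonempty)
  moreover have "(theta2 ^ 16 * (ty * tz)) $ M = 0"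
    using shadow16_quartic_nth[of a] unfolding tx_power_4 M(1) by (simp add: fps_X_power_mult_nth)
  ultimately show "sph_design 16 (shadow_shell 16 (4 * real a + 2)) 5"
    unfolding m
    by (intro sph_design_5I shadow_shell_antipodal shadow_design_cond_2 shadow_design_cond_4)
qed

end
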